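(* Let $K$ be a compact connected Lie group, let $f,g\colon K\to\mathbb C$ be $K$-finite functions, and suppose that $f$ is positive-definite. If $\mathrm{Cst}(f^k)=0$ for all integers $k\ge 1$, then $\mathrm{Cst}(f^k g)=0$ for all but finitely many $k$.
   Context: Let $G$ be the complexification of $K$. A function $f\colon K\to\mathbb C$ is called $K$-finite if it has the form $f(u)=\langle v,\phi(u)w\rangle$ for some finite-dimensional rational representation $\phi\colon G\to\mathrm{GL}(V)$ with $K$-invariant Hermitian inner product (linear in the second argument) and vectors $v,w\in V$. If one may take $v=w$, then $f$ is called positive-definite. (This is the paper's terminology.) The constant term of $f$ is $\mathrm{Cst}(f)=\int_K f(u)\,du$, where $du$ is the Haar probability measure on $K$. $f^k$ denotes the pointwise $k$-th power. *)

theory Defs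
  imports
    "HOL-Analysis.Analysis"
    "HOL-Probability.Probability_Measure"
    "HOL-Algebra.Group"
    "Jordan_Normal_Form.Determinant"
begin

(* Charts take values in a linear subspace E of a Euclidean space, not in a whole
   euclidean_space type: such a type has dimension at least 1, and 0-dimensional groups
   (e.g. the trivial one) must be covered.  S is meant to be relatively open in E; only
   directions v in E are considered, because a derivative within S is determined on E only. *)

primrec Ck_on ::
  "nat \<Rightarrow> 'e::real_normed_vector set \<Rightarrow> 'e set \<Rightarrow> ('e \<Rightarrow> 'b::real_normed_vector) \<Rightarrow> bool" where
  "Ck_on 0 E S f \<longleftrightarrow> continuous_on S f"
| "Ck_on (Suc k) E S f \<longleftrightarrow>
     f differentiable_on S \<and> (\<forall>v\<in>E. Ck_on k E S (\<lambda>x. frechet_derivative f (at x within S) v))"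

definition smooth_on ::
  "'e::real_normed_vector set \<Rightarrow> 'e set \<Rightarrow> ('e \<Rightarrow> 'b::real_normed_vector) \<Rightarrow> bool" where
  "smooth_on E S f \<longleftrightarrow> (\<forall>k. Ck_on k E S f)"

definition smooth_atlas ::
  "'a topology \<Rightarrow> 'e::euclidean_space set \<Rightarrow> ('a set \<times> ('a \<Rightarrow> 'e)) set \<Rightarrow> bool" where
  "smooth_atlas T E A \<longleftrightarrow>
     (\<Union>(U, \<psi>)\<in>A. U) = topspace T \<and>
     (\<forall>(U, \<psi>)\<in>A. openin T U \<and> openin (top_of_set E) (\<psi> ` U) \<and>
        homeomorphic_map (subtopology T U) (top_of_set (\<psi> ` U)) \<psi>) \<and>
     (\<forall>(U1, \<psi>1)\<in>A. \<forall>(U2, \<psi>2)\<in>A.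
        smooth_on E (\<psi>1 ` (U1 \<inter> U2)) (\<lambda>p. \<psi>2 (inv_into U1 \<psi>1 p)))"

definition smooth_function ::
  "'e::euclidean_space set \<Rightarrow> ('a set \<times> ('a \<Rightarrow> 'e)) set \<Rightarrow> ('a \<Rightarrow> 'b::real_normed_vector) \<Rightarrow> bool" where
  "smooth_function E A h \<longleftrightarrow>
     (\<forall>(U, \<psi>)\<in>A. smooth_on E (\<psi> ` U) (\<lambda>p. h (inv_into U \<psi> p)))"

locale lie_group = group K for K (structure) +
  fixes T :: "'a topology"
    and E :: "'e::euclidean_space set"
    and A :: "('a set \<times> ('a \<Rightarrow> 'e)) set"
  assumes topspace_eq: "topspace T = carrier K"
    and Hausdorff: "Hausdorff_space T"
    and second_countable: "second_countable T"
    and subspace_E: "subspace E"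
    and atlas: "smooth_atlas T E A"
    and continuous_mult: "continuous_map (prod_topology T T) T (\<lambda>(x, y). x \<otimes> y)"
    and continuous_inv: "continuous_map T T (\<lambda>x. inv x)"
    and smooth_mult:
      "\<lbrakk>(U1, \<psi>1) \<in> A; (U2, \<psi>2) \<in> A; (U3, \<psi>3) \<in> A\<rbrakk> \<Longrightarrow>
         smooth_on (E \<times> E) {(\<psi>1 x, \<psi>2 y) | x y. x \<in> U1 \<and> y \<in> U2 \<and> x \<otimes> y \<in> U3}
           (\<lambda>(p, q). \<psi>3 (inv_into U1 \<psi>1 p \<otimes> inv_into U2 \<psi>2 q))"
    and smooth_inv:
      "\<lbrakk>(U1, \<psi>1) \<in> A; (U2, \<psi>2) \<in> A\<rbrakk> \<Longrightarrow>
         smooth_on E (\<psi>1 ` {x \<in> U1. inv x \<in> U2}) (\<lambda>p. \<psi>2 (inv (inv_into U1 \<psi>1 p)))"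

definition GL :: "nat \<Rightarrow> complex mat monoid" where
  "GL n = units_of (ring_mat TYPE(complex) n ())"

inductive_set regular_functions :: "nat \<Rightarrow> (complex mat \<Rightarrow> complex) set" for n :: nat where
  const: "(\<lambda>_. c) \<in> regular_functions n"
| entry: "i < n \<Longrightarrow> j < n \<Longrightarrow> (\<lambda>g. g $$ (i, j)) \<in> regular_functions n"
| inverse_det: "(\<lambda>g. inverse (Determinant.det g)) \<in> regular_functions n"
| add: "p \<in> regular_functions n \<Longrightarrow> q \<in> regular_functions n \<Longrightarrow>
    (\<lambda>g. p g + q g) \<in> regular_functions n"
| mult: "p \<in> regular_functions n \<Longrightarrow> q \<in> regular_functions n \<Longrightarrow>
    (\<lambda>g. p g * q g) \<in> regular_functions n"

definition linear_algebraic_group :: "nat \<Rightarrow> complex mat set \<Rightarrow> bool" where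
  "linear_algebraic_group n G \<longleftrightarrow>
     subgroup G (GL n) \<and>
     (\<exists>P \<subseteq> regular_functions n. G = {g \<in> carrier (GL n). \<forall>p\<in>P. p g = 0})"

definition rational_homs ::
  "nat \<Rightarrow> complex mat set \<Rightarrow> nat \<Rightarrow> complex mat set \<Rightarrow> (complex mat \<Rightarrow> complex mat) set" where
  "rational_homs m G n H =
     {\<phi> \<in> hom (GL m\<lparr>carrier := G\<rparr>) (GL n\<lparr>carrier := H\<rparr>).
        \<forall>i<n. \<forall>j<n. \<exists>p\<in>regular_functions m. \<forall>g\<in>G. \<phi> g $$ (i, j) = p g}"

definition lie_group_homs ::
  "('a, 'b) monoid_scheme \<Rightarrow> 'e::euclidean_space set \<Rightarrow> ('a set \<times> ('a \<Rightarrow> 'e)) set \<Rightarrow>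
     nat \<Rightarrow> complex mat set \<Rightarrow> ('a \<Rightarrow> complex mat) set" where
  "lie_group_homs K E A n H =
     {\<rho> \<in> hom K (GL n\<lparr>carrier := H\<rparr>).
        \<forall>i<n. \<forall>j<n. smooth_function E A (\<lambda>u. \<rho> u $$ (i, j))}"

(* The complexification, characterised by its universal property among complex linear
   algebraic groups: every Lie group homomorphism from K to such a group H extends uniquely
   along \<iota> to a rational homomorphism G -> H.  For compact K this is the usual (reductive)
   complexification, and \<iota> is injective.  The extensional condition only normalises
   the values of \<phi> outside G. *)

definition complexification ::
  "('a, 'b) monoid_scheme \<Rightarrow> 'e::euclidean_space set \<Rightarrow> ('a set \<times> ('a \<Rightarrow> 'e)) set \<Rightarrow>
     nat \<Rightarrow> complex mat set \<Rightarrow> ('a \<Rightarrow> complex mat) \<Rightarrow> bool" where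
  "complexification K E A m G \<iota> \<longleftrightarrow>
     linear_algebraic_group m G \<and> \<iota> \<in> lie_group_homs K E A m G \<and>
     (\<forall>n H. \<forall>\<rho>\<in>lie_group_homs K E A n H. linear_algebraic_group n H \<longrightarrow>
        (\<exists>!\<phi>. \<phi> \<in> rational_homs m G n H \<and> \<phi> \<in> extensional G \<and>
           (\<forall>u\<in>carrier K. \<phi> (\<iota> u) = \<rho> u)))"

definition hermitian_inner_product ::
  "nat \<Rightarrow> (complex Matrix.vec \<Rightarrow> complex Matrix.vec \<Rightarrow> complex) \<Rightarrow> bool" where
  "hermitian_inner_product n h \<longleftrightarrow>
     (\<forall>x\<in>carrier_vec n. \<forall>y\<in>carrier_vec n. \<forall>z\<in>carrier_vec n. h x (y + z) = h x y + h x z) \<and>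
     (\<forall>x\<in>carrier_vec n. \<forall>y\<in>carrier_vec n. \<forall>c. h x (c \<cdot>\<^sub>v y) = c * h x y) \<and>
     (\<forall>x\<in>carrier_vec n. \<forall>y\<in>carrier_vec n. h y x = cnj (h x y)) \<and>
     (\<forall>x\<in>carrier_vec n. x \<noteq> 0\<^sub>v n \<longrightarrow> 0 < Re (h x x))"

definition matrix_coefficient ::
  "('a, 'b) monoid_scheme \<Rightarrow> nat \<Rightarrow> complex mat set \<Rightarrow> ('a \<Rightarrow> complex mat) \<Rightarrow> ('a \<Rightarrow> complex) \<Rightarrow>
     nat \<Rightarrow> (complex mat \<Rightarrow> complex mat) \<Rightarrow> (complex Matrix.vec \<Rightarrow> complex Matrix.vec \<Rightarrow> complex) \<Rightarrow>
     complex Matrix.vec \<Rightarrow> complex Matrix.vec \<Rightarrow> bool" where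
  "matrix_coefficient K m G \<iota> f n \<phi> h v w \<longleftrightarrow>
     \<phi> \<in> rational_homs m G n (carrier (GL n)) \<and>
     hermitian_inner_product n h \<and>
     (\<forall>u\<in>carrier K. \<forall>x\<in>carrier_vec n. \<forall>y\<in>carrier_vec n.
        h (\<phi> (\<iota> u) *\<^sub>v x) (\<phi> (\<iota> u) *\<^sub>v y) = h x y) \<and>
     v \<in> carrier_vec n \<and> w \<in> carrier_vec n \<and>
     (\<forall>u\<in>carrier K. f u = h v (\<phi> (\<iota> u) *\<^sub>v w))"

definition K_finite ::
  "('a, 'b) monoid_scheme \<Rightarrow> nat \<Rightarrow> complex mat set \<Rightarrow> ('a \<Rightarrow> complex mat) \<Rightarrow> ('a \<Rightarrow> complex) \<Rightarrow> bool"
  where "K_finite K m G \<iota> f \<longleftrightarrow> (\<exists>n \<phi> h v w. matrix_coefficient K m G \<iota> f n \<phi> h v w)"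

definition positive_definite ::
  "('a, 'b) monoid_scheme \<Rightarrow> nat \<Rightarrow> complex mat set \<Rightarrow> ('a \<Rightarrow> complex mat) \<Rightarrow> ('a \<Rightarrow> complex) \<Rightarrow> bool"
  where "positive_definite K m G \<iota> f \<longleftrightarrow> (\<exists>n \<phi> h v. matrix_coefficient K m G \<iota> f n \<phi> h v v)"

(* No regularity axiom is needed: on a compact Lie group, which is second countable, every
   Borel probability measure is regular. *)

definition haar_probability ::
  "('a, 'b) monoid_scheme \<Rightarrow> 'a topology \<Rightarrow> 'a measure \<Rightarrow> bool" where
  "haar_probability K T \<mu> \<longleftrightarrow>
     prob_space \<mu> \<and> space \<mu> = carrier K \<and>
     sets \<mu> = sigma_sets (topspace T) {U. openin T U} \<and>
     (\<forall>a\<in>carrier K. \<forall>B\<in>sets \<mu>. measure \<mu> ((\<lambda>x. a \<otimes>\<^bsub>K\<^esub> x) ` B) = measure \<mu> B)"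

definition Cst :: "'a measure \<Rightarrow> ('a \<Rightarrow> complex) \<Rightarrow> complex" where
  "Cst \<mu> f = (LINT u|\<mu>. f u)"

end

theory Submission
  imports Defs "HOL-Library.Function_Algebras"
begin

text \<open>
  Write \<open>f(u) = \<langle>v, \<phi>(u)v\<rangle>\<close> and \<open>g(u) = \<langle>a, \<psi>(u)b\<rangle>\<close>, and let \<open>X(u)\<close>, \<open>Y(u)\<close>, \<open>Z(u)\<close> be the
  orthonormal coordinates of \<open>\<phi>(u)v\<close>, \<open>\<psi>(u)a\<close>, \<open>\<psi>(u)b\<close>.  The tensor \<open>\<integral> X(u)\<^sup>\<otimes>\<^sup>k du\<close> has squared norm
  \<open>Cst(f\<^sup>k) = 0\<close>, so every monomial of positive degree in \<open>X\<close> has mean zero.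

  By translation invariance, \<open>F\<^sub>k(x, y) = \<integral> \<langle>x, X(u)\<rangle>\<^sup>k \<langle>y, Z(u)\<rangle> du\<close> takes the constant value
  \<open>Cst(f\<^sup>k g)\<close> at all points \<open>(X(s), Y(s))\<close>.  Let \<open>k\<close> run through the exponents with \<open>Cst(f\<^sup>k g) \<noteq> 0\<close>.
  If there were infinitely many, then by Hilbert's basis theorem some \<open>F\<^sub>k\<close> would be a combination
  \<open>\<Sum> p\<^sub>j F\<^sub>j\<close> of earlier ones.  Averaging this relation over the points \<open>(X(s), Y(s))\<close> kills all
  components of \<open>p\<^sub>j\<close> of positive degree, in particular those of degree \<open>k - j\<close>, whence
  \<open>Cst(f\<^sup>k g) = 0\<close>.
\<close>

section \<open>Hilbert's basis theorem for subrings\<close>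

text \<open>Rings are encoded as subsets of a type, because the ring used in the end depends on the
  given coordinate functions and on their number.\<close>

definition unital_subring :: "'a::comm_ring_1 set \<Rightarrow> bool" where
  "unital_subring R \<longleftrightarrow> 1 \<in> R \<and> (\<forall>a\<in>R. - a \<in> R) \<and> (\<forall>a\<in>R. \<forall>b\<in>R. a + b \<in> R \<and> a * b \<in> R)"

lemma unital_subringD:
  assumes "unital_subring R"
  shows "1 \<in> R" "0 \<in> R" "a \<in> R \<Longrightarrow> - a \<in> R" "a \<in> R \<Longrightarrow> b \<in> R \<Longrightarrow> a + b \<in> R"
    "a \<in> R \<Longrightarrow> b \<in> R \<Longrightarrow> a * b \<in> R"
proof -
  show "0 \<in> R"
    using assms unfolding unital_subring_def by (metis add.right_inverse)
qed (use assms in \<open>auto simp: unital_subring_def\<close>)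

lemma unital_subring_sum:
  assumes "unital_subring R" and "\<And>i. i \<in> I \<Longrightarrow> a i \<in> R"
  shows "sum a I \<in> R"
  using assms(2) by (induction I rule: infinite_finite_induct)
    (auto intro: unital_subringD[OF assms(1)])

text \<open>For \<open>S\<close> inside a subring \<open>R\<close> this is the ideal of
  \<open>R\<close> generated by \<open>S\<close>. Adding one term at a time provides induction over
  a combination.\<close>

inductive_set lin_span :: "'a::comm_ring_1 set \<Rightarrow> 'a set \<Rightarrow> 'a set" for R S where
  zero: "0 \<in> lin_span R S"
| step: "a \<in> R \<Longrightarrow> s \<in> S \<Longrightarrow> q \<in> lin_span R S \<Longrightarrow> a * s + q \<in> lin_span R S"

lemma lin_span_mono: "S \<subseteq> S' \<Longrightarrow> p \<in> lin_span R S \<Longrightarrow> p \<in> lin_span R S'"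
  by (rotate_tac, induction rule: lin_span.induct) (auto intro: lin_span.intros)

lemma lin_span_add:
  "p \<in> lin_span R S \<Longrightarrow> q \<in> lin_span R S \<Longrightarrow> p + q \<in> lin_span R S"
  by (induction rule: lin_span.induct) (auto simp: add.assoc intro: lin_span.intros)

lemma lin_span_mult:
  assumes "unital_subring R" "a \<in> R" "p \<in> lin_span R S"
  shows "a * p \<in> lin_span R S"
  using assms(3)
proof induction
  case (step b s q)
  have "a * (b * s + q) = (a * b) * s + a * q"
    by (simp add: algebra_simps)
  then show ?case
    using step assms by (auto intro: lin_span.intros unital_subringD)
qed (auto intro: lin_span.intros)

lemma lin_span_diff:
  assumes "unital_subring R" "p \<in> lin_span R S" "q \<in> lin_span R S"
  shows "p - q \<in> lin_span R S"
proof -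
  have "p + (- 1) * q \<in> lin_span R S"
    by (intro lin_span_add lin_span_mult assms unital_subringD[OF assms(1)])
  then show ?thesis by simp
qed

lemma lin_span_base:
  assumes "unital_subring R" "s \<in> S"
  shows "s \<in> lin_span R S"
  using lin_span.step[OF unital_subringD(1)[OF assms(1)] assms(2) lin_span.zero] by simp

text \<open>The ascending chain condition, phrased through sequences so that it directly yields a
  relation between one term and its predecessors. The witness \<open>N = 0\<close> means
  \<open>F 0 = 0\<close>.\<close>

definition noetherian_subring :: "'a::comm_ring_1 set \<Rightarrow> bool" where
  "noetherian_subring R \<longleftrightarrow> unital_subring R \<and>
     (\<forall>F::nat \<Rightarrow> 'a. range F \<subseteq> R \<longrightarrow> (\<exists>N. F N \<in> lin_span R (F ` {..<N})))"

lemma noetherian_subringD: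
  fixes F :: "nat \<Rightarrow> 'a::comm_ring_1"
  assumes "noetherian_subring R"
  shows "unital_subring R" and "(\<And>k. F k \<in> R) \<Longrightarrow> \<exists>N. F N \<in> lin_span R (F ` {..<N})"
  using assms unfolding noetherian_subring_def by (simp_all add: image_subset_iff)

lemma noetherian_subringI:
  assumes "unital_subring R"
    and "\<And>F::nat \<Rightarrow> _. (\<And>k. F k \<in> R) \<Longrightarrow> \<exists>N. F N \<in> lin_span R (F ` {..<N})"
  shows "noetherian_subring R"
  using assms unfolding noetherian_subring_def by (simp add: image_subset_iff)

section \<open>Polynomial rings over a subring and finitely generated extensions\<close>

definition polys_over :: "'a::comm_ring_1 set \<Rightarrow> 'a poly set" where
  "polys_over R = {p. \<forall>i. coeff p i \<in> R}"

text \<open>The image of \<open>R[X]\<close> under evaluation; \<open>x\<close> may satisfy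
  relations over \<open>R\<close>, so this is a quotient of the polynomial ring.\<close>

definition adjoin :: "'a::comm_ring_1 set \<Rightarrow> 'a \<Rightarrow> 'a set" where
  "adjoin R x = (\<lambda>p. poly p x) ` polys_over R"

lemma unital_subring_polys_over:
  assumes "unital_subring R"
  shows "unital_subring (polys_over R)"
proof -
  note R = unital_subringD[OF assms]
  have "coeff (p * q) i \<in> R" if "p \<in> polys_over R" "q \<in> polys_over R" for p q i
    unfolding coeff_mult
    by (intro unital_subring_sum[OF assms] R(5)) (use that in \<open>simp_all add: polys_over_def\<close>)
  moreover have "coeff 1 i \<in> R" for i
    using R(1,2) by (cases i) simp_all
  ultimately show ?thesis
    using R(3,4) by (simp add: unital_subring_def polys_over_def)
qed

lemma unital_subring_adjoin:
  assumes "unital_subring R"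
  shows "unital_subring (adjoin R x)"
proof -
  note P = unital_subringD[OF unital_subring_polys_over[OF assms]]
  have "1 \<in> adjoin R x"
    unfolding adjoin_def using P(1) by (rule image_eqI[rotated]) simp
  moreover have "- poly p x \<in> adjoin R x" if "p \<in> polys_over R" for p
    unfolding adjoin_def using P(3)[OF that] by (rule image_eqI[rotated]) simp
  moreover have "poly p x + poly q x \<in> adjoin R x"
    if "p \<in> polys_over R" "q \<in> polys_over R" for p q
    unfolding adjoin_def using P(4)[OF that] by (rule image_eqI[rotated]) simp
  moreover have "poly p x * poly q x \<in> adjoin R x"
    if "p \<in> polys_over R" "q \<in> polys_over R" for p q
    unfolding adjoin_def using P(5)[OF that] by (rule image_eqI[rotated]) simp
  ultimately show ?thesis
    unfolding unital_subring_def by (auto simp: adjoin_def)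
qed

lemma monom_in_polys_over: "unital_subring R \<Longrightarrow> a \<in> R \<Longrightarrow> monom a k \<in> polys_over R"
  by (auto simp: polys_over_def intro: unital_subringD)

lemma adjoin_extends:
  assumes "unital_subring R"
  shows "R \<subseteq> adjoin R x" "x \<in> adjoin R x"
proof -
  show "R \<subseteq> adjoin R x"
  proof
    fix a assume "a \<in> R"
    with monom_in_polys_over[OF assms this, of 0] show "a \<in> adjoin R x"
      by (force simp: adjoin_def poly_monom)
  qed
  show "x \<in> adjoin R x"
    using monom_in_polys_over[OF assms unital_subringD(1)[OF assms], of 1]
    by (force simp: adjoin_def poly_monom)
qed

text \<open>A minimiser of \<open>d\<close> on any tail is such an index. Enumerating these indices
  gives a subsequence along which \<open>d\<close> is nondecreasing.\<close>

lemma infinite_min_from: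
  fixes d :: "nat \<Rightarrow> nat"
  shows "infinite {k. \<forall>j\<ge>k. d k \<le> d j}"
  unfolding infinite_nat_iff_unbounded_le
proof
  fix M
  obtain k where "k \<ge> M" "\<And>j. j \<ge> M \<Longrightarrow> d k \<le> d j"
    using ex_has_least_nat[of "\<lambda>k. k \<ge> M" M d] by auto
  then show "\<exists>k\<ge>M. k \<in> {k. \<forall>j\<ge>k. d k \<le> d j}"
    by (intro exI[of _ k]) auto
qed

text \<open>Each \<open>P k\<close> is replaced by a polynomial \<open>f k\<close> of least degree among those congruent to it
  modulo the preceding ones.  A linear relation among the leading coefficients along a
  subsequence of nondecreasing degree then contradicts minimality.\<close>

lemma hilbert_basis_polys:
  assumes R: "noetherian_subring R"
  shows "noetherian_subring (polys_over R)"
proof -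
  note sub = noetherian_subringD(1)[OF R]
  note subP = unital_subring_polys_over[OF sub]
  have "\<exists>N. P N \<in> lin_span (polys_over R) (P ` {..<N})" if P: "\<And>k. P k \<in> polys_over R" for P :: "nat \<Rightarrow> _"
  proof (rule ccontr)
    assume neg: "\<nexists>N. P N \<in> lin_span (polys_over R) (P ` {..<N})"
    define J where "J N = lin_span (polys_over R) (P ` {..<N})" for N
    have J_sub: "p \<in> polys_over R" if "p \<in> J N" for p N
      using that unfolding J_def
      by induction (use P in \<open>auto intro: unital_subringD[OF subP]\<close>)
    have J_mono: "p \<in> J N" if "p \<in> J M" "M \<le> N" for p M N
    proof -
      have "P ` {..<M} \<subseteq> P ` {..<N}"
        using that(2) by auto
      then show ?thesis
        using that(1) unfolding J_def by (rule lin_span_mono)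
    qed
    have "\<exists>f. P k - f \<in> J k \<and> (\<forall>g. P k - g \<in> J k \<longrightarrow> degree f \<le> degree g)" for k
      using ex_has_least_nat[of "\<lambda>f. P k - f \<in> J k" "P k" degree]
      by (auto simp: J_def intro: lin_span.zero)
    then obtain f where f: "\<And>k. P k - f k \<in> J k"
      and f_min: "\<And>k g. P k - g \<in> J k \<Longrightarrow> degree (f k) \<le> degree g"
      by metis
    have f_poly: "f k \<in> polys_over R" for k
    proof -
      have "P k + - (P k - f k) \<in> polys_over R"
        using P J_sub[OF f[of k]] by (intro unital_subringD[OF subP]) auto
      then show ?thesis by simp
    qed
    have f_J: "f j \<in> J k" if "j < k" for j k
    proof -
      have "P j \<in> J k"
        unfolding J_def using that by (intro lin_span_base[OF subP]) auto
      moreover have "P j - f j \<in> J k"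
        using J_mono[OF f[of j], of k] that by simp
      ultimately have "P j - (P j - f j) \<in> J k"
        unfolding J_def by (rule lin_span_diff[OF subP])
      then show ?thesis by simp
    qed
    define S where "S = {k. \<forall>j\<ge>k. degree (f k) \<le> degree (f j)}"
    define e where "e = enumerate S"
    have "infinite S"
      unfolding S_def by (rule infinite_min_from)
    then have e: "strict_mono e" "\<And>i. e i \<in> S"
      unfolding e_def by (auto intro: strict_mono_enumerate enumerate_in_set)
    have "lead_coeff (f (e i)) \<in> R" for i
      using f_poly by (simp add: polys_over_def)
    from noetherian_subringD(2)[OF R, of "\<lambda>i. lead_coeff (f (e i))", OF this] obtain N where
      N: "lead_coeff (f (e N)) \<in> lin_span R ((\<lambda>i. lead_coeff (f (e i))) ` {..<N})"
      by blast
    define D where "D = degree (f (e N))"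
    \<comment> \<open>A combination of leading coefficients lifts to the ideal: a monomial factor
      raises \<open>f (e i)\<close> to degree \<open>D\<close>. The exponent is a true difference
      because degrees do not decrease along \<open>e\<close>.\<close>
    have "\<exists>q\<in>J (e N). degree q \<le> D \<and> coeff q D = c"
      if "c \<in> lin_span R ((\<lambda>i. lead_coeff (f (e i))) ` {..<N})" for c
      using that
    proof induction
      case zero
      show ?case
        by (rule bexI[of _ 0]) (auto simp: J_def intro: lin_span.zero)
    next
      case (step r a c)
      then obtain q i where q: "q \<in> J (e N)" "degree q \<le> D" "coeff q D = c"
        and i: "i < N" "a = lead_coeff (f (e i))" by auto
      have less: "e i < e N"
        using e(1) i(1) by (simp add: strict_mono_def)
      have le: "degree (f (e i)) \<le> D"
        using e(2)[of i] less by (auto simp: S_def D_def)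
      define q' where "q' = monom r (D - degree (f (e i))) * f (e i)"
      have "q' \<in> J (e N)"
        unfolding q'_def J_def
        by (intro lin_span_mult[OF subP] monom_in_polys_over[OF sub] step f_J[unfolded J_def] less)
      moreover have "degree q' \<le> D"
        unfolding q'_def
        using degree_mult_le[of "monom r (D - degree (f (e i)))" "f (e i)"]
          degree_monom_le[of r "D - degree (f (e i))"] le by linarith
      moreover have "coeff q' D = r * a"
        using le by (simp add: q'_def i coeff_monom_mult)
      ultimately show ?case
        using q by (intro bexI[of _ "q' + q"])
          (auto simp: J_def intro!: lin_span_add degree_add_le)
    qed
    from this[OF N] obtain q where
      q: "q \<in> J (e N)" "degree q \<le> D" "coeff q D = lead_coeff (f (e N))" by blast
    \<comment> \<open>Subtracting \<open>q\<close> cancels the leading term and keeps the class of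
      \<open>P (e N)\<close> modulo \<open>J (e N)\<close>. Minimality leaves only
      \<open>g = 0\<close>, which puts \<open>P (e N)\<close> itself into
      \<open>J (e N)\<close>.\<close>
    define g where "g = f (e N) - q"
    have "P (e N) - g = (P (e N) - f (e N)) + q"
      by (simp add: g_def)
    then have g_J: "P (e N) - g \<in> J (e N)"
      using f[of "e N"] q(1) unfolding J_def by (metis lin_span_add)
    have "degree g \<le> D"
      unfolding g_def by (rule degree_diff_le) (use q in \<open>auto simp: D_def\<close>)
    moreover have "D \<le> degree g"
      unfolding D_def by (rule f_min[OF g_J])
    moreover have "coeff g D = 0"
      using q by (simp add: g_def D_def)
    ultimately have "g = 0"
      by (metis leading_coeff_0_iff le_antisym)
    with g_J neg show False
      by (auto simp: J_def)
  qed
  with subP show ?thesis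
    by (rule noetherian_subringI)
qed

text \<open>The sequence is lifted to polynomials over \<open>R\<close>; the relation found there
  survives evaluation at \<open>x\<close>.\<close>

lemma hilbert_basis_adjoin:
  assumes R: "noetherian_subring R"
  shows "noetherian_subring (adjoin R x)"
proof -
  have "\<exists>N. F N \<in> lin_span (adjoin R x) (F ` {..<N})" if F: "\<And>k. F k \<in> adjoin R x" for F :: "nat \<Rightarrow> _"
  proof -
    have "\<exists>p. p \<in> polys_over R \<and> F k = poly p x" for k
      using F[of k] unfolding adjoin_def by blast
    then obtain P where P: "\<And>k. P k \<in> polys_over R" "\<And>k. F k = poly (P k) x"
      by metis
    then obtain N where "P N \<in> lin_span (polys_over R) (P ` {..<N})"
      using noetherian_subringD(2)[OF hilbert_basis_polys[OF R], of P] by blast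
    then have "poly (P N) x \<in> lin_span (adjoin R x) (F ` {..<N})"
    proof induction
      case (step a p q)
      then obtain i where "i < N" "p = P i" by auto
      with step show ?case
        unfolding poly_add poly_mult \<open>p = P i\<close> P(2)[symmetric]
        by (intro lin_span.step) (auto simp: adjoin_def)
    qed (simp add: lin_span.zero)
    then show ?thesis
      unfolding P(2)[symmetric] by blast
  qed
  with unital_subring_adjoin[OF noetherian_subringD(1)[OF R]] show ?thesis
    by (rule noetherian_subringI)
qed

abbreviation adjoin_list :: "'a::comm_ring_1 set \<Rightarrow> 'a list \<Rightarrow> 'a set" where
  "adjoin_list \<equiv> foldl adjoin"

lemma noetherian_adjoin_list: "noetherian_subring R \<Longrightarrow> noetherian_subring (adjoin_list R xs)"
  by (induction xs arbitrary: R) (auto intro: hilbert_basis_adjoin)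

lemma adjoin_list_extends:
  "unital_subring R \<Longrightarrow> R \<union> set xs \<subseteq> adjoin_list R xs"
proof (induction xs arbitrary: R)
  case (Cons x xs)
  show ?case
    using Cons.IH[OF unital_subring_adjoin[OF Cons.prems], of x] adjoin_extends[OF Cons.prems, of x]
    by auto
qed simp

text \<open>By Horner's scheme, elements of \<open>R[x]\<close> arise from \<open>R\<close> by
  additions and multiplications by \<open>x\<close>. Stability under the generators thus replaces
  closure under products, which is how \<open>averageable\<close> is treated below.\<close>

lemma adjoin_list_subset:
  assumes "R \<subseteq> S" "0 \<in> S" "\<And>p q. p \<in> S \<Longrightarrow> q \<in> S \<Longrightarrow> p + q \<in> S"
    and "\<And>x p. x \<in> set xs \<Longrightarrow> p \<in> S \<Longrightarrow> x * p \<in> S"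
  shows "adjoin_list R xs \<subseteq> S"
  using assms(1,4)
proof (induction xs arbitrary: R)
  case (Cons x xs)
  have "poly p x \<in> S" if "p \<in> polys_over R" for p
    using that
  proof (induction p)
    case (pCons a p)
    have coeff: "coeff (pCons a p) i \<in> R" for i
      using pCons.prems by (simp add: polys_over_def)
    from coeff[of "Suc _"] have "poly p x \<in> S"
      by (intro pCons.IH) (simp add: polys_over_def)
    with coeff[of 0] Cons.prems have "a + x * poly p x \<in> S"
      by (intro assms(3)) auto
    then show ?case by simp
  qed (use assms in simp)
  then have "adjoin R x \<subseteq> S"
    by (auto simp: adjoin_def)
  with Cons show ?case
    by simp
qed auto

text \<open>In a field, a nonzero \<open>F 0\<close> divides \<open>F 1\<close>, so the witness is 0
  or 1.\<close>

lemma noetherian_constants: "noetherian_subring (range (\<lambda>(c::'b::field) (_::'a). c))"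
proof -
  let ?R = "range (\<lambda>(c::'b) (_::'a). c)"
  have "unital_subring ?R"
    by (auto simp: unital_subring_def one_fun_def fun_Compl_def plus_fun_def times_fun_def)
  moreover have "\<exists>N. F N \<in> lin_span ?R (F ` {..<N})" if F: "\<And>k. F k \<in> ?R" for F :: "nat \<Rightarrow> _"
  proof (cases "F 0 = 0")
    case True
    then show ?thesis by (intro exI[of _ 0]) (auto intro: lin_span.zero)
  next
    case False
    obtain a b where ab: "F 0 = (\<lambda>_. a)" "F 1 = (\<lambda>_. b)"
      using F[of 0] F[of 1] by blast
    with False have "a \<noteq> 0"
      by (auto simp: zero_fun_def)
    then have "F 1 = (\<lambda>_. b / a) * F 0 + 0"
      unfolding ab by (simp add: times_fun_def)
    also have "\<dots> \<in> lin_span ?R (F ` {..<1})"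
      by (intro lin_span.intros) auto
    finally show ?thesis by blast
  qed
  ultimately show ?thesis
    by (rule noetherian_subringI)
qed

section \<open>Averages of powers on a probability space\<close>

text \<open>Bounded measurable functions, unlike integrable ones, are closed under products, and on
  a probability space they are integrable.\<close>

definition bounded_rv :: "'a measure \<Rightarrow> ('a \<Rightarrow> complex) \<Rightarrow> bool" where
  "bounded_rv M X \<longleftrightarrow> X \<in> borel_measurable M \<and> (\<exists>B. \<forall>u\<in>space M. norm (X u) \<le> B)"

lemma bounded_rv_const: "bounded_rv M (\<lambda>_. c)"
  by (auto simp: bounded_rv_def)

lemma bounded_rv_cnj: "bounded_rv M X \<Longrightarrow> bounded_rv M (\<lambda>u. cnj (X u))"
  by (auto simp: bounded_rv_def
      intro: borel_measurable_continuous_on[OF continuous_on_cnj[OF continuous_on_id]])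

lemma bounded_rv_add:
  assumes "bounded_rv M X" "bounded_rv M Y"
  shows "bounded_rv M (\<lambda>u. X u + Y u)"
proof -
  from assms obtain A B where "\<And>u. u \<in> space M \<Longrightarrow> norm (X u) \<le> A" "\<And>u. u \<in> space M \<Longrightarrow> norm (Y u) \<le> B"
    by (auto simp: bounded_rv_def)
  then have "\<forall>u\<in>space M. norm (X u + Y u) \<le> A + B"
    by (auto intro: norm_triangle_mono)
  with assms show ?thesis
    by (auto simp: bounded_rv_def)
qed

lemma bounded_rv_mult:
  assumes "bounded_rv M X" "bounded_rv M Y"
  shows "bounded_rv M (\<lambda>u. X u * Y u)"
proof -
  from assms obtain A B where "\<And>u. u \<in> space M \<Longrightarrow> norm (X u) \<le> A" "\<And>u. u \<in> space M \<Longrightarrow> norm (Y u) \<le> B"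
    by (auto simp: bounded_rv_def)
  then have "\<forall>u\<in>space M. norm (X u * Y u) \<le> A * B"
    by (smt (verit) mult_mono norm_ge_zero norm_mult)
  with assms show ?thesis
    by (auto simp: bounded_rv_def)
qed

lemma bounded_rv_sum:
  "(\<And>i. i \<in> I \<Longrightarrow> bounded_rv M (X i)) \<Longrightarrow> bounded_rv M (\<lambda>u. \<Sum>i\<in>I. X i u)"
  by (induction I rule: infinite_finite_induct) (auto intro: bounded_rv_const bounded_rv_add)

lemma bounded_rv_power: "bounded_rv M X \<Longrightarrow> bounded_rv M (\<lambda>u. X u ^ k)"
  by (induction k) (auto intro: bounded_rv_const bounded_rv_mult)

lemma bounded_rv_prod_list:
  "(\<And>i. i \<in> set w \<Longrightarrow> bounded_rv M (X i)) \<Longrightarrow> bounded_rv M (\<lambda>u. prod_list (map (\<lambda>i. X i u) w))"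
  by (induction w) (auto intro: bounded_rv_const bounded_rv_mult)

lemmas bounded_rv_intros = bounded_rv_const bounded_rv_cnj bounded_rv_add bounded_rv_mult
  bounded_rv_sum bounded_rv_power bounded_rv_prod_list

lemma (in prob_space) integrable_bounded_rv: "bounded_rv M X \<Longrightarrow> integrable M X"
  unfolding bounded_rv_def by (auto intro: integrable_const_bound)

section \<open>Powers of sums as sums over words\<close>

definition words :: "nat \<Rightarrow> nat \<Rightarrow> nat list set" where
  "words n k = {w. set w \<subseteq> {..<n} \<and> length w = k}"

text \<open>The \<open>k\<close> factors are distributed without collecting equal monomials, which
  avoids multinomial coefficients; words index the entries of a \<open>k\<close>-th tensor
  power.\<close>

lemma power_sum_words:
  fixes a b :: "nat \<Rightarrow> 'c::comm_semiring_1"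
  shows "(\<Sum>i<n. a i * b i) ^ k =
    (\<Sum>w\<in>words n k. prod_list (map a w) * prod_list (map b w))"
proof (induction k)
  case 0
  have "words n 0 = {[]}"
    by (auto simp: words_def)
  then show ?case by simp
next
  case (Suc k)
  have "words n (Suc k) = (\<lambda>(i, w). i # w) ` ({..<n} \<times> words n k)"
    by (force simp: words_def length_Suc_conv)
  moreover have "inj_on (\<lambda>(i, w). i # w) ({..<n} \<times> words n k)"
    by (auto simp: inj_on_def)
  ultimately have "(\<Sum>w\<in>words n (Suc k). prod_list (map a w) * prod_list (map b w)) =
      (\<Sum>(i, w)\<in>{..<n} \<times> words n k. (a i * b i) * (prod_list (map a w) * prod_list (map b w)))"
    by (simp add: sum.reindex case_prod_unfold ac_simps)
  also have "\<dots> = (\<Sum>i<n. a i * b i) ^ Suc k"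
    by (simp add: Suc sum_product sum.cartesian_product)
  finally show ?case by simp
qed

lemma sum_fun_apply: "sum F I x = (\<Sum>i\<in>I. F i x)" for F :: "'i \<Rightarrow> 'p \<Rightarrow> 'c::comm_monoid_add"
  by (induction I rule: infinite_finite_induct) (simp_all add: zero_fun_def plus_fun_def)

text \<open>Serves to divide an identity by \<open>\<sigma>\<close> and then evaluate it at
  \<open>\<sigma> = 0\<close>.\<close>

lemma continuous_eq_at_0:
  fixes g :: "complex \<Rightarrow> complex"
  assumes "continuous_on UNIV g" and "\<And>\<sigma>. \<sigma> \<noteq> 0 \<Longrightarrow> g \<sigma> = c"
  shows "g 0 = c"
proof -
  have "(g \<longlongrightarrow> g 0) (at 0)"
    using assms(1) by (simp add: continuous_on_def)
  moreover have "(g \<longlongrightarrow> c) (at 0)"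
    by (rule tendsto_eventually) (use assms(2) in \<open>auto simp: eventually_at_filter\<close>)
  ultimately show ?thesis
    by (rule LIM_unique)
qed

lemma cnj_prod_list: "cnj (prod_list (map a w)) = prod_list (map (\<lambda>i. cnj (a i)) w)"
  by (induction w) simp_all

text \<open>The group enters only through the two integral identities: translation invariance makes
  both integrals independent of \<open>s\<close>. Here \<open>C k\<close> stands for
  \<open>Cst(f^k g)\<close>.\<close>

locale power_family = prob_space M for M :: "'a measure" +
  fixes n m :: nat and X Y Z :: "nat \<Rightarrow> 'a \<Rightarrow> complex" and C :: "nat \<Rightarrow> complex"
  assumes bounded: "i < n \<Longrightarrow> bounded_rv M (X i)" "j < m \<Longrightarrow> bounded_rv M (Y j)"
      "j < m \<Longrightarrow> bounded_rv M (Z j)"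
    and integral_power: "k \<ge> 1 \<Longrightarrow> s \<in> space M \<Longrightarrow>
      (LINT u|M. (\<Sum>i<n. cnj (X i s) * X i u) ^ k) = 0"
    and integral_power_mult: "s \<in> space M \<Longrightarrow>
      (LINT u|M. (\<Sum>i<n. cnj (X i s) * X i u) ^ k * (\<Sum>j<m. cnj (Y j s) * Z j u)) = C k"
begin

definition word_prod :: "nat list \<Rightarrow> 'a \<Rightarrow> complex" where
  "word_prod w u = prod_list (map (\<lambda>i. X i u) w)"

lemma word_prod_Cons: "word_prod (i # w) u = X i u * word_prod w u"
  by (simp add: word_prod_def)

lemma bounded_word_prod: "set w \<subseteq> {..<n} \<Longrightarrow> bounded_rv M (word_prod w)"
  unfolding word_prod_def by (intro bounded_rv_prod_list bounded) auto

text \<open>The squared norm of the averaged tensor power \<open>\<integral> X(u)\<^sup>\<otimes>\<^sup>k du\<close>, whose entries are indexed by words,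
  is \<open>\<integral>\<integral> \<langle>X(s), X(u)\<rangle>\<^sup>k du ds = 0\<close>.\<close>

lemma integral_word_prod_eq_0:
  assumes w: "set w \<subseteq> {..<n}" "w \<noteq> []"
  shows "(LINT u|M. word_prod w u) = 0"
proof -
  define k where "k = length w"
  define I where "I v = (LINT u|M. word_prod v u)" for v
  have fin: "finite (words n k)"
    unfolding words_def by (rule finite_lists_length_eq) simp
  have int: "integrable M (word_prod v)" if "v \<in> words n k" for v
    using that by (auto simp: words_def intro!: integrable_bounded_rv bounded_word_prod)
  have "(\<Sum>v\<in>words n k. cnj (I v) * I v) = (\<Sum>v\<in>words n k. LINT s|M. cnj (word_prod v s) * I v)"
    by (simp add: I_def)
  also have "\<dots> = (LINT s|M. (\<Sum>v\<in>words n k. cnj (word_prod v s) * I v))"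
    by (rule Bochner_Integration.integral_sum[symmetric]) (use int in simp)
  also have "\<dots> = (LINT s|M. 0)"
  proof (rule Bochner_Integration.integral_cong)
    fix s assume s: "s \<in> space M"
    have "(\<Sum>v\<in>words n k. cnj (word_prod v s) * I v) =
        (LINT u|M. (\<Sum>v\<in>words n k. cnj (word_prod v s) * word_prod v u))"
      unfolding I_def using int by (subst Bochner_Integration.integral_sum) simp_all
    also have "\<dots> = (LINT u|M. (\<Sum>i<n. cnj (X i s) * X i u) ^ k)"
      by (simp add: power_sum_words word_prod_def cnj_prod_list)
    also have "\<dots> = 0"
      using w by (intro integral_power s) (simp add: k_def Suc_le_eq)
    finally show "(\<Sum>v\<in>words n k. cnj (word_prod v s) * I v) = 0" .
  qed simp
  finally have "complex_of_real (\<Sum>v\<in>words n k. (cmod (I v))\<^sup>2) = 0"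
    by (simp only: of_real_sum complex_norm_square mult.commute Bochner_Integration.integral_zero)
  then have "(\<Sum>v\<in>words n k. (cmod (I v))\<^sup>2) = 0"
    by (simp only: of_real_eq_0_iff)
  then have "\<forall>v\<in>words n k. (cmod (I v))\<^sup>2 = 0"
    by (subst (asm) sum_nonneg_eq_0_iff) (auto simp: fin)
  moreover have "w \<in> words n k"
    using w by (simp add: words_def k_def)
  ultimately show ?thesis
    by (simp add: I_def)
qed

text \<open>The variable \<open>t\<close> records the degree in \<open>X\<close> and \<open>\<sigma>\<close> the degree in \<open>Y\<close>.\<close>

definition gen_X :: "nat \<Rightarrow> 'a \<times> complex \<times> complex \<Rightarrow> complex" where
  "gen_X i = (\<lambda>(s, t, \<sigma>). t * cnj (X i s))"

definition gen_Y :: "nat \<Rightarrow> 'a \<times> complex \<times> complex \<Rightarrow> complex" where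
  "gen_Y j = (\<lambda>(s, t, \<sigma>). \<sigma> * cnj (Y j s))"

text \<open>A quotient of a polynomial ring in \<open>n + m\<close> variables over the complex
  numbers, hence Noetherian. The conjugates in the generators come from the antilinear argument of
  the inner product.\<close>

definition coord_ring :: "('a \<times> complex \<times> complex \<Rightarrow> complex) set" where
  "coord_ring = adjoin_list (range (\<lambda>c _. c)) (map gen_X [0..<n] @ map gen_Y [0..<m])"

lemma noetherian_coord_ring: "noetherian_subring coord_ring"
  unfolding coord_ring_def by (intro noetherian_adjoin_list noetherian_constants)

lemmas subring_coord_ring = noetherian_subringD(1)[OF noetherian_coord_ring]

lemma coord_ring_intros:
  "(\<lambda>_. c) \<in> coord_ring" "i < n \<Longrightarrow> gen_X i \<in> coord_ring" "j < m \<Longrightarrow> gen_Y j \<in> coord_ring"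
  using adjoin_list_extends[OF noetherian_subringD(1)[OF noetherian_constants],
      of "map gen_X [0..<n] @ map gen_Y [0..<m]"]
  unfolding coord_ring_def by auto

text \<open>For the empty word, the last condition says that the mean over \<open>s\<close> at
  \<open>\<sigma> = 0\<close> is independent of \<open>t\<close>: parts of positive degree in
  \<open>X\<close> average to zero. All words are included so that the condition passes through
  multiplication by \<open>gen_X\<close>. Continuity prepares the division by
  \<open>\<sigma>\<close>.\<close>

definition averageable :: "('a \<times> complex \<times> complex \<Rightarrow> complex) set" where
  "averageable = {p. (\<forall>s t. continuous_on UNIV (\<lambda>\<sigma>. p (s, t, \<sigma>))) \<and>
     (\<forall>t. bounded_rv M (\<lambda>s. p (s, t, 0))) \<and>
     (\<forall>w. set w \<subseteq> {..<n} \<longrightarrow>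
        (\<exists>c. \<forall>t. (LINT s|M. p (s, t, 0) * (t ^ length w * cnj (word_prod w s))) = c))}"

lemma coord_ring_averageable: "coord_ring \<subseteq> averageable"
  unfolding coord_ring_def
proof (rule adjoin_list_subset)
  have "(\<lambda>_. c) \<in> averageable" for c
  proof -
    \<comment> \<open>For a nonempty word the mean of the conjugate monomial vanishes; for the empty
      word no power of \<open>t\<close> is present.\<close>
    have "\<exists>c'. \<forall>t. (LINT s|M. c * (t ^ length w * cnj (word_prod w s))) = c'"
      if "set w \<subseteq> {..<n}" for w
    proof (cases "w = []")
      case True
      then show ?thesis by (simp add: word_prod_def prob_space)
    next
      case False
      with integral_word_prod_eq_0[OF that] show ?thesis by simp
    qed
    then show ?thesis
      by (auto simp: averageable_def intro: bounded_rv_intros)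
  qed
  then show "range (\<lambda>c _. c) \<subseteq> averageable" "0 \<in> averageable"
    by (auto simp: zero_fun_def)
next
  fix p q assume p: "p \<in> averageable" and q: "q \<in> averageable"
  have "\<exists>c. \<forall>t. (LINT s|M. (p + q) (s, t, 0) * (t ^ length w * cnj (word_prod w s))) = c"
    if w: "set w \<subseteq> {..<n}" for w
  proof -
    from p q w obtain c d where
      c: "\<And>t. (LINT s|M. p (s, t, 0) * (t ^ length w * cnj (word_prod w s))) = c" and
      d: "\<And>t. (LINT s|M. q (s, t, 0) * (t ^ length w * cnj (word_prod w s))) = d"
      unfolding averageable_def by blast
    have "integrable M (\<lambda>s. p (s, t, 0) * (t ^ length w * cnj (word_prod w s)))"
      "integrable M (\<lambda>s. q (s, t, 0) * (t ^ length w * cnj (word_prod w s)))" for t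
      using p q bounded_word_prod[OF w]
      by (auto simp: averageable_def intro!: integrable_bounded_rv bounded_rv_intros)
    then have "(LINT s|M. (p + q) (s, t, 0) * (t ^ length w * cnj (word_prod w s))) = c + d" for t
      by (simp add: distrib_right c d)
    then show ?thesis by blast
  qed
  then show "p + q \<in> averageable"
    using p q by (auto simp: averageable_def intro: continuous_intros bounded_rv_intros)
next
  fix x p assume x: "x \<in> set (map gen_X [0..<n] @ map gen_Y [0..<m])" and p: "p \<in> averageable"
  from x consider (X) i where "i < n" "x = gen_X i" | (Y) j where "j < m" "x = gen_Y j"
    by auto
  then show "x * p \<in> averageable"
  proof cases
    case X
    have "\<exists>c. \<forall>t. (LINT s|M. (x * p) (s, t, 0) * (t ^ length w * cnj (word_prod w s))) = c"
      if w: "set w \<subseteq> {..<n}" for w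
    proof -
      \<comment> \<open>The factor \<open>t * cnj (X i s)\<close> is absorbed into the test
        monomial, turning \<open>w\<close> into \<open>i # w\<close>.\<close>
      have "set (i # w) \<subseteq> {..<n}"
        using w X by simp
      then obtain c where
        "\<And>t. (LINT s|M. p (s, t, 0) * (t ^ length (i # w) * cnj (word_prod (i # w) s))) = c"
        using p unfolding averageable_def by blast
      then show ?thesis
        by (intro exI[of _ c]) (simp add: X gen_X_def word_prod_Cons mult_ac)
    qed
    then show ?thesis
      using p X bounded(1)
      by (auto simp: averageable_def gen_X_def intro!: continuous_intros bounded_rv_intros)
  next
    case Y
    \<comment> \<open>Multiples of \<open>gen_Y j\<close> vanish at \<open>\<sigma> = 0\<close>, so
      all these averages are zero.\<close>
    then show ?thesis
      using p by (auto simp: averageable_def gen_Y_def intro!: continuous_intros bounded_rv_intros)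
  qed
qed

text \<open>Expanding one of the \<open>k\<close> factors brings out \<open>gen_X i\<close> and
  moves \<open>X i\<close> into the weight, which is why \<open>W\<close> is general. At
  \<open>k = 0\<close> a constant remains.\<close>

lemma integral_power_in_coord_ring:
  assumes "bounded_rv M W"
  shows "(\<lambda>(s, t, \<sigma>). LINT u|M. (\<Sum>i<n. t * cnj (X i s) * X i u) ^ k * W u) \<in> coord_ring"
  using assms
proof (induction k arbitrary: W)
  case 0
  show ?case
    using coord_ring_intros(1) by (simp add: case_prod_unfold)
next
  case (Suc k)
  let ?G = "\<lambda>k W. \<lambda>(s, t, \<sigma>). LINT u|M. (\<Sum>i<n. t * cnj (X i s) * X i u) ^ k * W u"
  have "?G (Suc k) W (s, t, \<sigma>) = (\<Sum>i<n. gen_X i * ?G k (\<lambda>u. X i u * W u)) (s, t, \<sigma>)" for s t \<sigma>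
  proof -
    let ?S = "\<lambda>u. \<Sum>i<n. t * cnj (X i s) * X i u"
    have int: "integrable M (\<lambda>u. ?S u ^ k * (X i u * W u))" if "i < n" for i
      using that Suc.prems bounded(1) by (auto intro!: integrable_bounded_rv bounded_rv_intros)
    have "?S u ^ Suc k * W u = (\<Sum>i<n. t * cnj (X i s) * (?S u ^ k * (X i u * W u)))" for u
      by (simp add: sum_distrib_left sum_distrib_right mult_ac)
    then have "?G (Suc k) W (s, t, \<sigma>) =
        (\<Sum>i<n. t * cnj (X i s) * (LINT u|M. ?S u ^ k * (X i u * W u)))"
      using int by (simp add: Bochner_Integration.integral_sum)
    then show ?thesis
      by (simp add: sum_fun_apply gen_X_def)
  qed
  then have eq: "?G (Suc k) W = (\<Sum>i<n. gen_X i * ?G k (\<lambda>u. X i u * W u))"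
    by auto
  show ?case
    unfolding eq
    by (intro unital_subring_sum unital_subringD subring_coord_ring coord_ring_intros Suc.IH
        bounded_rv_mult Suc.prems bounded) simp_all
qed

text \<open>The function \<open>F_k\<close> of the overview at \<open>(X(s), Y(s))\<close>, with the
  scalars \<open>t\<close> and \<open>\<sigma>\<close> inserted outside the conjugation, so that it
  is polynomial in them.\<close>

definition averaged_power :: "nat \<Rightarrow> 'a \<times> complex \<times> complex \<Rightarrow> complex" where
  "averaged_power k = (\<lambda>(s, t, \<sigma>). LINT u|M. (\<Sum>i<n. t * cnj (X i s) * X i u) ^ k *
      (\<Sum>j<m. \<sigma> * cnj (Y j s) * Z j u))"

lemma averaged_power_in_coord_ring: "averaged_power k \<in> coord_ring"
proof -
  let ?G = "\<lambda>W. \<lambda>(s, t, \<sigma>). LINT u|M. (\<Sum>i<n. t * cnj (X i s) * X i u) ^ k * W u"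
  have "averaged_power k (s, t, \<sigma>) = (\<Sum>j<m. gen_Y j * ?G (Z j)) (s, t, \<sigma>)" for s t \<sigma>
  proof -
    let ?S = "\<lambda>u. \<Sum>i<n. t * cnj (X i s) * X i u"
    have int: "integrable M (\<lambda>u. ?S u ^ k * Z j u)" if "j < m" for j
      using that bounded by (auto intro!: integrable_bounded_rv bounded_rv_intros)
    have "?S u ^ k * (\<Sum>j<m. \<sigma> * cnj (Y j s) * Z j u) =
        (\<Sum>j<m. \<sigma> * cnj (Y j s) * (?S u ^ k * Z j u))" for u
      by (subst sum_distrib_left) (simp add: mult_ac)
    then have "averaged_power k (s, t, \<sigma>) = (\<Sum>j<m. \<sigma> * cnj (Y j s) * (LINT u|M. ?S u ^ k * Z j u))"
      using int by (simp add: averaged_power_def Bochner_Integration.integral_sum)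
    then show ?thesis
      by (simp add: sum_fun_apply gen_Y_def)
  qed
  then have eq: "averaged_power k = (\<Sum>j<m. gen_Y j * ?G (Z j))"
    by auto
  show ?thesis
    unfolding eq
    by (intro unital_subring_sum unital_subringD subring_coord_ring coord_ring_intros
        integral_power_in_coord_ring bounded) simp_all
qed

lemma averaged_power_eq:
  assumes "s \<in> space M"
  shows "averaged_power k (s, t, \<sigma>) = \<sigma> * (t ^ k * C k)"
proof -
  have "(\<Sum>i<n. t * cnj (X i s) * X i u) ^ k * (\<Sum>j<m. \<sigma> * cnj (Y j s) * Z j u) =
     \<sigma> * t ^ k * ((\<Sum>i<n. cnj (X i s) * X i u) ^ k * (\<Sum>j<m. cnj (Y j s) * Z j u))" for u
    by (simp add: mult.assoc sum_distrib_left[symmetric] power_mult_distrib)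
  then show ?thesis
    using integral_power_mult[OF assms, of k] by (simp add: averaged_power_def)
qed

text \<open>Here \<open>q0\<close> plays the role of \<open>q / \<sigma>\<close>, extended
  continuously to \<open>\<sigma> = 0\<close>. A term \<open>p * averaged_power j\<close>
  contributes \<open>p * t^j * C j\<close> to it, whose mean at \<open>\<sigma> = 0\<close> is a
  constant times \<open>t^j\<close>. So only exponents from \<open>D\<close> occur in
  \<open>P\<close>.\<close>

lemma lin_span_average:
  assumes "q \<in> lin_span coord_ring (averaged_power ` D)" "k \<notin> D"
  shows "\<exists>q0 P. (\<forall>s\<in>space M. \<forall>t. continuous_on UNIV (\<lambda>\<sigma>. q0 (s, t, \<sigma>)) \<and>
        (\<forall>\<sigma>. q (s, t, \<sigma>) = \<sigma> * q0 (s, t, \<sigma>))) \<and>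
      (\<forall>t. bounded_rv M (\<lambda>s. q0 (s, t, 0)) \<and> (LINT s|M. q0 (s, t, 0)) = poly P t) \<and>
      coeff P k = 0"
  using assms(1)
proof induction
  case zero
  show ?case
    by (rule exI[of _ "\<lambda>_. 0"], rule exI[of _ 0]) (auto intro: bounded_rv_const)
next
  case (step p f q)
  then obtain j where j: "j \<in> D" "f = averaged_power j"
    by auto
  from step.IH obtain q0 P where
    q0: "\<And>s t. s \<in> space M \<Longrightarrow> continuous_on UNIV (\<lambda>\<sigma>. q0 (s, t, \<sigma>))"
      "\<And>s t \<sigma>. s \<in> space M \<Longrightarrow> q (s, t, \<sigma>) = \<sigma> * q0 (s, t, \<sigma>)"
      "\<And>t. bounded_rv M (\<lambda>s. q0 (s, t, 0))" "\<And>t. (LINT s|M. q0 (s, t, 0)) = poly P t"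
      "coeff P k = 0"
    by blast
  have "p \<in> averageable"
    using step.hyps coord_ring_averageable by blast
  then have p: "\<And>s t. continuous_on UNIV (\<lambda>\<sigma>. p (s, t, \<sigma>))"
      "\<And>t. bounded_rv M (\<lambda>s. p (s, t, 0))"
    and "set w \<subseteq> {..<n} \<Longrightarrow>
      \<exists>c. \<forall>t. (LINT s|M. p (s, t, 0) * (t ^ length w * cnj (word_prod w s))) = c" for w
    unfolding averageable_def by blast+
  \<comment> \<open>The empty word gives the plain mean of \<open>p\<close>, from which
    \<open>t\<close> has disappeared.\<close>
  from this(3)[of "[]"] obtain c where c: "\<And>t. (LINT s|M. p (s, t, 0)) = c"
    by (auto simp: word_prod_def)
  define q0' where "q0' = (\<lambda>(s, t, \<sigma>). p (s, t, \<sigma>) * (t ^ j * C j) + q0 (s, t, \<sigma>))"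
  define P' where "P' = monom (c * C j) j + P"
  have "continuous_on UNIV (\<lambda>\<sigma>. q0' (s, t, \<sigma>))" if "s \<in> space M" for s t
    unfolding q0'_def prod.case using that by (intro continuous_intros p q0)
  moreover have "(p * f + q) (s, t, \<sigma>) = \<sigma> * q0' (s, t, \<sigma>)" if "s \<in> space M" for s t \<sigma>
    using that by (simp add: j averaged_power_eq q0 q0'_def algebra_simps)
  moreover have "bounded_rv M (\<lambda>s. q0' (s, t, 0))" for t
    unfolding q0'_def prod.case by (intro bounded_rv_intros p q0)
  moreover have "(LINT s|M. q0' (s, t, 0)) = poly P' t" for t
  proof -
    have "integrable M (\<lambda>s. p (s, t, 0) * (t ^ j * C j))" "integrable M (\<lambda>s. q0 (s, t, 0))"
      by (intro integrable_bounded_rv bounded_rv_intros p q0)+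
    then show ?thesis
      by (simp add: q0'_def P'_def q0 c poly_monom)
  qed
  moreover have "coeff P' k = 0"
    using j assms(2) by (auto simp: P'_def q0)
  ultimately show ?case
    by blast
qed

lemma finite_C_nonzero: "finite {k. C k \<noteq> 0}"
proof (rule ccontr)
  assume inf: "infinite {k. C k \<noteq> 0}"
  \<comment> \<open>Only exponents with nonzero \<open>C\<close> are enumerated, so that deriving
    \<open>C (e N) = 0\<close> is a contradiction.\<close>
  define e where "e = enumerate {k. C k \<noteq> 0}"
  obtain N where "averaged_power (e N) \<in> lin_span coord_ring ((\<lambda>i. averaged_power (e i)) ` {..<N})"
    using noetherian_subringD(2)[OF noetherian_coord_ring, of "\<lambda>i. averaged_power (e i)"] averaged_power_in_coord_ring
    by blast
  then have span: "averaged_power (e N) \<in> lin_span coord_ring (averaged_power ` e ` {..<N})"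
    by (simp add: image_image)
  have "strict_mono e"
    unfolding e_def by (rule strict_mono_enumerate[OF inf])
  then have "e N \<notin> e ` {..<N}"
    by (auto simp: strict_mono_eq)
  from lin_span_average[OF span this] obtain q0 P where
    q0: "\<And>s t. s \<in> space M \<Longrightarrow> continuous_on UNIV (\<lambda>\<sigma>. q0 (s, t, \<sigma>))"
      "\<And>s t \<sigma>. s \<in> space M \<Longrightarrow> averaged_power (e N) (s, t, \<sigma>) = \<sigma> * q0 (s, t, \<sigma>)"
      "\<And>t. (LINT s|M. q0 (s, t, 0)) = poly P t" "coeff P (e N) = 0"
    by blast
  have "q0 (s, t, 0) = t ^ e N * C (e N)" if s: "s \<in> space M" for s t
  proof (rule continuous_eq_at_0[OF q0(1)[OF s]])
    fix \<sigma> :: complex assume "\<sigma> \<noteq> 0"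
    with q0(2)[OF s, of t \<sigma>] averaged_power_eq[OF s, of "e N" t \<sigma>] show "q0 (s, t, \<sigma>) = t ^ e N * C (e N)"
      by simp
  qed
  then have "(LINT s|M. q0 (s, t, 0)) = (LINT s|M. t ^ e N * C (e N))" for t
    by (intro Bochner_Integration.integral_cong) auto
  \<comment> \<open>Averaging over \<open>s\<close> leaves an identity of polynomials in
    \<open>t\<close>. Its coefficient at \<open>e N\<close> is zero on one side and
    \<open>C (e N)\<close> on the other.\<close>
  then have "poly P t = poly (monom (C (e N)) (e N)) t" for t
    using q0(3)[of t] by (simp add: prob_space poly_monom mult.commute)
  then have "P = monom (C (e N)) (e N)"
    by (simp add: poly_eq_poly_eq_iff[symmetric] fun_eq_iff)
  with q0(4) have "C (e N) = 0"
    by simp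
  moreover have "C (e N) \<noteq> 0"
    using enumerate_in_set[OF inf, of N] by (simp add: e_def)
  ultimately show False by simp
qed

end

section \<open>Hermitian forms as sums of squares\<close>

definition linear_functional :: "nat \<Rightarrow> (complex Matrix.vec \<Rightarrow> complex) \<Rightarrow> bool" where
  "linear_functional n l \<longleftrightarrow>
     (\<forall>x\<in>carrier_vec n. \<forall>y\<in>carrier_vec n. l (x + y) = l x + l y) \<and>
     (\<forall>x\<in>carrier_vec n. \<forall>c. l (c \<cdot>\<^sub>v x) = c * l x)"

lemma linear_functional_expand:
  assumes l: "linear_functional n l" and x: "x \<in> carrier_vec n"
  shows "l x = (\<Sum>i<n. vec_index x i * l (unit_vec n i))"
proof -
  \<comment> \<open>The truncation \<open>tr d\<close> keeps the first \<open>d\<close> coordinates;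
    induction on \<open>d\<close> leads from the zero vector to \<open>x\<close>.\<close>
  define tr where "tr d = Matrix.vec n (\<lambda>i. if i < d then vec_index x i else 0)" for d
  have "d \<le> n \<Longrightarrow> l (tr d) = (\<Sum>i<d. vec_index x i * l (unit_vec n i))" for d
  proof (induction d)
    case 0
    have "l (0 \<cdot>\<^sub>v tr 0) = 0 * l (tr 0)"
      using l unfolding linear_functional_def by (metis tr_def vec_carrier)
    moreover have "0 \<cdot>\<^sub>v tr 0 = tr 0"
      by (auto simp: tr_def)
    ultimately show ?case by simp
  next
    case (Suc d)
    have "tr (Suc d) = tr d + vec_index x d \<cdot>\<^sub>v unit_vec n d"
      using Suc.prems by (auto simp: tr_def unit_vec_def less_Suc_eq)
    moreover have "tr d \<in> carrier_vec n" "unit_vec n d \<in> carrier_vec n"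
      "vec_index x d \<cdot>\<^sub>v unit_vec n d \<in> carrier_vec n"
      by (simp_all add: tr_def)
    ultimately have "l (tr (Suc d)) = l (tr d) + vec_index x d * l (unit_vec n d)"
      using l by (simp add: linear_functional_def)
    with Suc show ?case by simp
  qed
  moreover have "tr n = x"
    using x by (auto simp: tr_def)
  ultimately show ?thesis by (metis le_refl)
qed

text \<open>Definiteness is lost once a square has been split off, whereas semidefiniteness
  survives.\<close>

definition semidefinite_form ::
  "nat \<Rightarrow> (complex Matrix.vec \<Rightarrow> complex Matrix.vec \<Rightarrow> complex) \<Rightarrow> bool" where
  "semidefinite_form n h \<longleftrightarrow> (\<forall>x\<in>carrier_vec n. linear_functional n (h x)) \<and>
     (\<forall>x\<in>carrier_vec n. \<forall>y\<in>carrier_vec n. h y x = cnj (h x y)) \<and>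
     (\<forall>x\<in>carrier_vec n. 0 \<le> Re (h x x))"

lemma semidefinite_form_linear:
  "semidefinite_form n h \<Longrightarrow> x \<in> carrier_vec n \<Longrightarrow> linear_functional n (h x)"
  unfolding semidefinite_form_def by blast

lemma semidefinite_formD:
  assumes "semidefinite_form n h"
    and "x \<in> carrier_vec n" "y \<in> carrier_vec n" "z \<in> carrier_vec n"
  shows "h x (y + z) = h x y + h x z" "h x (c \<cdot>\<^sub>v y) = c * h x y"
    "h (x + y) z = h x z + h y z" "h (c \<cdot>\<^sub>v x) y = cnj c * h x y"
    "h y x = cnj (h x y)" "0 \<le> Re (h x x)" "Im (h x x) = 0"
proof -
  have form: "linear_functional n (h x)" "0 \<le> Re (h x x)" if "x \<in> carrier_vec n" for x
    using assms(1) that unfolding semidefinite_form_def by blast+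
  have herm: "h y x = cnj (h x y)" if "x \<in> carrier_vec n" "y \<in> carrier_vec n" for x y
    using assms(1) that unfolding semidefinite_form_def by blast
  have lin: "h x (y + z) = h x y + h x z" "h x (c \<cdot>\<^sub>v y) = c * h x y"
    if "x \<in> carrier_vec n" "y \<in> carrier_vec n" "z \<in> carrier_vec n" for x y z c
    using form(1)[OF that(1)] that unfolding linear_functional_def by blast+
  show "h x (y + z) = h x y + h x z" "h x (c \<cdot>\<^sub>v y) = c * h x y" "h y x = cnj (h x y)"
    by (fact lin[OF assms(2-4)] herm[OF assms(2,3)])+
  show "0 \<le> Re (h x x)"
    by (rule form(2)[OF assms(2)])
  show "Im (h x x) = 0"
    using herm[OF assms(2) assms(2)] by (simp add: complex_eq_iff)
  have "h (x + y) z = cnj (h z (x + y))"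
    using assms by (intro herm) auto
  also have "\<dots> = h x z + h y z"
    using assms lin(1)[of z x y] herm[of z x] herm[of z y] by simp
  finally show "h (x + y) z = h x z + h y z" .
  have "h (c \<cdot>\<^sub>v x) y = cnj (h y (c \<cdot>\<^sub>v x))"
    using assms by (intro herm) auto
  also have "\<dots> = cnj c * h x y"
    using assms lin(2)[of y x x] herm[of y x] by simp
  finally show "h (c \<cdot>\<^sub>v x) y = cnj c * h x y" .
qed

text \<open>If \<open>h x x = 0\<close>, the value of the form at \<open>c x + y\<close> is
  real-affine in \<open>c\<close>, so it stays nonnegative only if \<open>h x y = 0\<close>.\<close>

lemma semidefinite_form_null:
  assumes h: "semidefinite_form n h" and x: "x \<in> carrier_vec n" and y: "y \<in> carrier_vec n"
    and null: "h x x = 0"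
  shows "h x y = 0"
proof (rule ccontr)
  assume "h x y \<noteq> 0"
  \<comment> \<open>These choices of \<open>r\<close> and \<open>c\<close> make the real part of the
    form at \<open>c x + y\<close> exactly \<open>-1\<close>.\<close>
  define r where "r = (Re (h y y) + 1) / (2 * (cmod (h x y))\<^sup>2)"
  define c where "c = - complex_of_real r * h x y"
  note D = semidefinite_formD[OF h]
  have cx: "c \<cdot>\<^sub>v x \<in> carrier_vec n" using x by simp
  have "h (c \<cdot>\<^sub>v x + y) (c \<cdot>\<^sub>v x + y) =
      c * cnj c * h x x + cnj c * h x y + c * cnj (h x y) + h y y"
    using D(1)[of "c \<cdot>\<^sub>v x + y" "c \<cdot>\<^sub>v x" y] D(2)[of "c \<cdot>\<^sub>v x + y" x x c] D(3)[of "c \<cdot>\<^sub>v x" y y]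
      D(3)[of "c \<cdot>\<^sub>v x" y x] D(4)[of x x x c] D(4)[of x y y c] D(5)[of x y x] x y cx
    by (simp add: algebra_simps)
  also have "\<dots> = h y y - complex_of_real (2 * r * (cmod (h x y))\<^sup>2)"
    by (simp add: null c_def complex_norm_square[of "h x y", unfolded of_real_power] algebra_simps)
  also have "2 * r * (cmod (h x y))\<^sup>2 = Re (h y y) + 1"
    using \<open>h x y \<noteq> 0\<close> by (simp add: r_def)
  finally have "Re (h (c \<cdot>\<^sub>v x + y) (c \<cdot>\<^sub>v x + y)) = - 1"
    by simp
  moreover have "0 \<le> Re (h (c \<cdot>\<^sub>v x + y) (c \<cdot>\<^sub>v x + y))"
    using cx y by (intro D(6)[of _ y y]) auto
  ultimately show False by simp
qed

text \<open>If \<open>h e e = 0\<close>, then \<open>h e\<close> vanishes already, and the division by zero gives \<open>l = 0\<close>.\<close>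

lemma semidefinite_form_split:
  assumes h: "semidefinite_form n h" and e: "e \<in> carrier_vec n"
    and l_def: "l = (\<lambda>y. h e y / complex_of_real (sqrt (Re (h e e))))"
    and h'_def: "h' = (\<lambda>x y. h x y - cnj (l x) * l y)"
  shows "linear_functional n l" "semidefinite_form n h'" "\<And>y. y \<in> carrier_vec n \<Longrightarrow> h' e y = 0"
    "\<And>x y. x \<in> carrier_vec n \<Longrightarrow> y \<in> carrier_vec n \<Longrightarrow> h x e = 0 \<Longrightarrow> h' x y = h x y"
proof -
  note D = semidefinite_formD[OF h]
  define r where "r = Re (h e e)"
  have r: "r \<ge> 0" "h e e = complex_of_real r"
    using D(6,7)[OF e e e] by (simp_all add: r_def complex_eq_iff)
  have sq: "complex_of_real (sqrt r) * complex_of_real (sqrt r) = complex_of_real r"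
    using r(1) by (simp flip: of_real_mult)
  have h': "h' x y = h x y - cnj (h e x) * h e y / complex_of_real r" for x y
    by (simp add: h'_def l_def sq flip: r_def)
  show l: "linear_functional n l"
    using D(1)[OF e] D(2)[OF e _ e] unfolding linear_functional_def l_def
    by (simp add: add_divide_distrib)
  show null: "h' e y = 0" if "y \<in> carrier_vec n" for y
    using semidefinite_form_null[OF h e that] by (cases "r = 0") (auto simp: h' r(2))
  show "h' x y = h x y" if "x \<in> carrier_vec n" "y \<in> carrier_vec n" "h x e = 0"
    for x y :: "complex Matrix.vec"
    using that D(5)[OF that(1) e e] by (simp add: h')
  show "semidefinite_form n h'"
    unfolding semidefinite_form_def
  proof (intro conjI ballI)
    fix x :: "complex Matrix.vec" assume x: "x \<in> carrier_vec n"
    show "linear_functional n (h' x)"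
      using l D(1)[OF x] D(2)[OF x _ x] unfolding linear_functional_def h'_def
      by (simp add: algebra_simps)
    show "0 \<le> Re (h' x x)"
    proof -
      \<comment> \<open>The vector \<open>x + c e\<close> is the component of \<open>x\<close> that
        is \<open>h\<close>-orthogonal to \<open>e\<close>, and \<open>h' x x\<close> is its squared
        norm. For \<open>r = 0\<close>, division by zero gives \<open>c = 0\<close>.\<close>
      define c where "c = - (h e x / complex_of_real r)"
      have ce: "c \<cdot>\<^sub>v e \<in> carrier_vec n" using e by simp
      have "h (x + c \<cdot>\<^sub>v e) (x + c \<cdot>\<^sub>v e) =
          h x x + c * cnj (h e x) + cnj c * (h e x + c * h e e)"
        using D(1)[of "x + c \<cdot>\<^sub>v e" x "c \<cdot>\<^sub>v e"] D(2)[of "x + c \<cdot>\<^sub>v e" e e c] D(3)[of x "c \<cdot>\<^sub>v e" x]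
          D(3)[of x "c \<cdot>\<^sub>v e" e] D(4)[of e x x c] D(4)[of e e e c] D(5)[of e x x] x e ce
        by (simp add: algebra_simps)
      also have "cnj c * (h e x + c * h e e) = 0"
        by (cases "r = 0") (simp_all add: c_def r(2))
      also have "h x x + c * cnj (h e x) + 0 = h' x x"
        by (simp add: c_def h')
      finally have "h' x x = h (x + c \<cdot>\<^sub>v e) (x + c \<cdot>\<^sub>v e)" by simp
      moreover have "0 \<le> Re (h (x + c \<cdot>\<^sub>v e) (x + c \<cdot>\<^sub>v e))"
        using x ce by (intro D(6)[of _ x x]) auto
      ultimately show ?thesis by simp
    qed
    fix y :: "complex Matrix.vec" assume y: "y \<in> carrier_vec n"
    show "h' y x = cnj (h' x y)"
      using D(5)[OF x y y] by (simp add: h'_def mult.commute)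
  qed
qed

text \<open>Gram-Schmidt along the standard basis, carried out by completing squares: each new
  square puts one more basis vector into the radical of the remainder.\<close>

lemma semidefinite_form_decompose:
  assumes h: "semidefinite_form n h" and "d \<le> n"
  shows "\<exists>l h'. (\<forall>i<d. linear_functional n (l i)) \<and> semidefinite_form n h' \<and>
     (\<forall>i<d. \<forall>y\<in>carrier_vec n. h' (unit_vec n i) y = 0) \<and>
     (\<forall>x\<in>carrier_vec n. \<forall>y\<in>carrier_vec n. h x y = h' x y + (\<Sum>i<d. cnj (l i x) * l i y))"
  using assms(2)
proof (induction d)
  case 0
  show ?case
    by (rule exI, rule exI[of _ h]) (simp add: h)
next
  case (Suc d)
  obtain l h1 where "\<forall>i<d. linear_functional n (l i)" and h1: "semidefinite_form n h1"
    and "\<forall>i<d. \<forall>y\<in>carrier_vec n. h1 (unit_vec n i) y = 0"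
    and "\<forall>x\<in>carrier_vec n. \<forall>y\<in>carrier_vec n. h x y = h1 x y + (\<Sum>i<d. cnj (l i x) * l i y)"
    using Suc.IH[OF Suc_leD[OF Suc.prems]] by (elim exE conjE) (rule that)
  then have l: "\<And>i. i < d \<Longrightarrow> linear_functional n (l i)"
    and null: "\<And>i y. i < d \<Longrightarrow> y \<in> carrier_vec n \<Longrightarrow> h1 (unit_vec n i) y = 0"
    and eq: "\<And>x y. x \<in> carrier_vec n \<Longrightarrow> y \<in> carrier_vec n \<Longrightarrow>
      h x y = h1 x y + (\<Sum>i<d. cnj (l i x) * l i y)"
    by blast+
  define e where "e = (unit_vec n d :: complex Matrix.vec)"
  have e: "e \<in> carrier_vec n"
    by (simp add: e_def)
  define ld where "ld = (\<lambda>y. h1 e y / complex_of_real (sqrt (Re (h1 e e))))"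
  define h2 where "h2 = (\<lambda>x y. h1 x y - cnj (ld x) * ld y)"
  note split = semidefinite_form_split[OF h1 e ld_def h2_def]
  show ?case
  proof (intro exI[of _ "l(d := ld)"] exI[of _ h2] conjI ballI allI impI)
    show "linear_functional n ((l(d := ld)) i)" if "i < Suc d" for i
      using that l split(1) by (cases "i = d") auto
    show "semidefinite_form n h2"
      by (rule split(2))
    show "h2 (unit_vec n i) y = 0" if "i < Suc d" "y \<in> carrier_vec n" for i y
    proof (cases "i = d")
      case True
      with split(3)[OF that(2)] show ?thesis by (simp add: e_def)
    next
      case False
      \<comment> \<open>Earlier basis vectors are \<open>h1\<close>-orthogonal to \<open>e\<close>,
        so the new square leaves them in the radical.\<close>
      with that null[OF _ that(2), of i] null[OF _ e, of i] split(4)[of "unit_vec n i" y]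
      show ?thesis by simp
    qed
    show "h x y = h2 x y + (\<Sum>i<Suc d. cnj ((l(d := ld)) i x) * (l(d := ld)) i y)"
      if "x \<in> carrier_vec n" "y \<in> carrier_vec n" for x y
      using eq[OF that] by (simp add: h2_def)
  qed
qed

text \<open>The functionals \<open>l i\<close> act as orthonormal coordinates. After
  \<open>n\<close> steps every basis vector is in the radical of the remainder, which is therefore
  zero.\<close>

lemma hermitian_sum_of_squares:
  assumes h: "hermitian_inner_product n h"
  obtains l where "\<And>i. i < n \<Longrightarrow> linear_functional n (l i)"
    and "\<And>x y. x \<in> carrier_vec n \<Longrightarrow> y \<in> carrier_vec n \<Longrightarrow> h x y = (\<Sum>i<n. cnj (l i x) * l i y)"
proof -
  have lin: "linear_functional n (h x)" if "x \<in> carrier_vec n" for x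
    using h that unfolding hermitian_inner_product_def linear_functional_def by blast
  have "0 \<le> Re (h x x)" if x: "x \<in> carrier_vec n" for x
  proof (cases "x = 0\<^sub>v n")
    case True
    \<comment> \<open>Positivity is given for nonzero vectors; at zero, homogeneity yields
      \<open>h x x = 0\<close>.\<close>
    have "h x (0 \<cdot>\<^sub>v x) = 0 * h x x"
      using lin[OF x] x unfolding linear_functional_def by blast
    moreover have "0 \<cdot>\<^sub>v x = x"
      using True by auto
    ultimately show ?thesis by simp
  next
    case False
    with h x show ?thesis
      unfolding hermitian_inner_product_def by (blast intro: less_imp_le)
  qed
  moreover have "h y x = cnj (h x y)" if "x \<in> carrier_vec n" "y \<in> carrier_vec n" for x y
    using h that unfolding hermitian_inner_product_def by blast
  ultimately have "semidefinite_form n h"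
    unfolding semidefinite_form_def using lin by blast
  from semidefinite_form_decompose[OF this order.refl] obtain l h'
    where "\<forall>i<n. linear_functional n (l i)" and h': "semidefinite_form n h'"
      and "\<forall>i<n. \<forall>y\<in>carrier_vec n. h' (unit_vec n i) y = 0"
      and "\<forall>x\<in>carrier_vec n. \<forall>y\<in>carrier_vec n. h x y = h' x y + (\<Sum>i<n. cnj (l i x) * l i y)"
    by (elim exE conjE) (rule that)
  then have l: "\<And>i. i < n \<Longrightarrow> linear_functional n (l i)"
    and null: "\<And>i y. i < n \<Longrightarrow> y \<in> carrier_vec n \<Longrightarrow> h' (unit_vec n i) y = 0"
    and eq: "\<And>x y. x \<in> carrier_vec n \<Longrightarrow> y \<in> carrier_vec n \<Longrightarrow>
      h x y = h' x y + (\<Sum>i<n. cnj (l i x) * l i y)"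
    by blast+
  have "h' x y = 0" if "x \<in> carrier_vec n" "y \<in> carrier_vec n" for x y
  proof -
    have "h' y (unit_vec n i) = 0" if "i < n" for i
      using null[OF that \<open>y \<in> carrier_vec n\<close>] semidefinite_formD(5)[OF h', of "unit_vec n i" y y]
        \<open>y \<in> carrier_vec n\<close> by simp
    then have "h' y x = 0"
      using linear_functional_expand[OF semidefinite_form_linear[OF h' that(2)] that(1)] by simp
    then show ?thesis
      using semidefinite_formD(5)[OF h' that(2,1,1)] by simp
  qed
  then have "h x y = (\<Sum>i<n. cnj (l i x) * l i y)"
    if "x \<in> carrier_vec n" "y \<in> carrier_vec n" for x y
    using eq[OF that] that by simp
  with l show ?thesis
    by (rule that)
qed

section \<open>Haar integrals of matrix coefficients\<close>

lemma continuous_map_tendsto_iff: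
  fixes f :: "'a \<Rightarrow> 'b::topological_space"
  shows "continuous_map X euclidean f \<longleftrightarrow> (\<forall>x\<in>topspace X. (f \<longlongrightarrow> f x) (atin X x))"
  by (simp add: continuous_map_atin)

text \<open>On a chart domain, \<open>h\<close> is the chart followed by a local expression whose
  order-0 smoothness is continuity; the pasting lemma glues over the open cover.\<close>

lemma smooth_function_continuous_map:
  assumes atlas: "smooth_atlas T E A" and h: "smooth_function E A h"
  shows "continuous_map T euclidean h"
proof (rule pasting_lemma[where I = A and T = fst and f = "\<lambda>_. h"])
  fix c assume c: "c \<in> A"
  obtain U \<psi> where c_eq: "c = (U, \<psi>)" by (cases c)
  have U: "openin T U" and \<psi>: "homeomorphic_map (subtopology T U) (top_of_set (\<psi> ` U)) \<psi>"
    using atlas c unfolding smooth_atlas_def c_eq by blast+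
  have "U \<subseteq> topspace T"
    using U by (rule openin_subset)
  then have inj: "inj_on \<psi> U"
    using homeomorphic_imp_injective_map[OF \<psi>] by (simp add: Int_absorb1)
  have "Ck_on 0 E (\<psi> ` U) (\<lambda>p. h (inv_into U \<psi> p))"
    using h c unfolding smooth_function_def smooth_on_def c_eq by blast
  then have "continuous_map (subtopology T U) euclidean ((\<lambda>p. h (inv_into U \<psi> p)) \<circ> \<psi>)"
    by (intro continuous_map_compose[OF homeomorphic_imp_continuous_map[OF \<psi>]]) simp
  then show "continuous_map (subtopology T (fst c)) euclidean h"
    unfolding c_eq fst_conv
    by (rule continuous_map_eq) (simp add: inv_into_f_f[OF inj])
  show "openin T (fst c)"
    using U by (simp add: c_eq)
next
  fix x assume "x \<in> topspace T"
  then have "x \<in> (\<Union>(U, \<psi>)\<in>A. U)"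
    using atlas by (simp add: smooth_atlas_def)
  then show "\<exists>c. c \<in> A \<and> x \<in> fst c \<and> h x = h x"
    by force
qed simp

lemma regular_function_continuous_map:
  assumes p: "p \<in> regular_functions m"
    and \<iota>: "\<And>u. u \<in> topspace T \<Longrightarrow> \<iota> u \<in> carrier_mat m m \<and> Determinant.det (\<iota> u) \<noteq> 0"
    and cont: "\<And>i j. i < m \<Longrightarrow> j < m \<Longrightarrow> continuous_map T euclidean (\<lambda>u. \<iota> u $$ (i, j))"
  shows "continuous_map T euclidean (\<lambda>u. p (\<iota> u))"
  using p
proof induction
  case (entry i j)
  then show ?case by (rule cont)
next
  case inverse_det
  \<comment> \<open>The Leibniz expansion reduces continuity of the determinant to that of the
    entries.\<close>
  have "continuous_map T euclidean (\<lambda>u. \<Sum>\<pi>\<in>{\<pi>. \<pi> permutes {0..<m}}.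
      signof \<pi> * (\<Prod>i = 0..<m. \<iota> u $$ (i, \<pi> i)))"
    unfolding continuous_map_tendsto_iff
  proof (intro ballI tendsto_intros)
    fix u \<pi> i assume "u \<in> topspace T" "\<pi> \<in> {\<pi>. \<pi> permutes {0..<m}}" "i \<in> {0..<m}"
    then show "((\<lambda>u. \<iota> u $$ (i, \<pi> i)) \<longlongrightarrow> \<iota> u $$ (i, \<pi> i)) (atin T u)"
      using cont[of i "\<pi> i"] permutes_in_image[of \<pi> "{0..<m}" i]
      by (simp add: continuous_map_tendsto_iff)
  qed
  then have "continuous_map T euclidean (\<lambda>u. Determinant.det (\<iota> u))"
    by (rule continuous_map_eq) (simp add: det_def'[where n = m] \<iota>)
  then show ?case
    unfolding continuous_map_tendsto_iff by (auto intro: tendsto_inverse simp: \<iota>)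
next
  case (add p q)
  then show ?case
    unfolding continuous_map_tendsto_iff by (auto intro: tendsto_add)
next
  case (mult p q)
  then show ?case
    unfolding continuous_map_tendsto_iff by (auto intro: tendsto_mult)
qed simp

lemma GL_carrierD:
  assumes "M \<in> carrier (GL n)"
  shows "M \<in> carrier_mat n n" "Determinant.det M \<noteq> 0"
proof -
  have unit: "M \<in> Units (ring_mat TYPE(complex) n ())"
    using assms by (simp add: GL_def units_of_def)
  then show "M \<in> carrier_mat n n"
    by (simp add: Units_def ring_mat_def)
  show "Determinant.det M \<noteq> 0"
    by (rule unit_imp_det_non_zero[OF unit])
qed

lemma GL_mult: "M \<otimes>\<^bsub>GL n\<^esub> N = M * N"
  by (simp add: GL_def units_of_def ring_mat_def)

section \<open>Haar integration and translates of matrix coefficients\<close>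

locale compact_haar = lie_group K T E A for K (structure) and T :: "'a topology"
    and E :: "'e::euclidean_space set" and A +
  fixes \<mu> :: "'a measure"
  assumes compact: "compact_space T" and haar: "haar_probability K T \<mu>"
begin

lemma prob_space_haar: "prob_space \<mu>"
  and space_haar: "space \<mu> = carrier K"
  and sets_haar: "sets \<mu> = sigma_sets (topspace T) {U. openin T U}"
  and measure_haar: "a \<in> carrier K \<Longrightarrow> B \<in> sets \<mu> \<Longrightarrow> measure \<mu> ((\<lambda>x. a \<otimes> x) ` B) = measure \<mu> B"
  using haar unfolding haar_probability_def by blast+

lemma openin_in_sets: "openin T U \<Longrightarrow> U \<in> sets \<mu>"
  by (simp add: sets_haar sigma_sets.Basic)

lemma continuous_bounded_rv:
  assumes X: "continuous_map T euclidean X"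
  shows "bounded_rv \<mu> X"
  unfolding bounded_rv_def
proof
  show "X \<in> borel_measurable \<mu>"
  proof (rule borel_measurableI)
    fix S :: "complex set" assume "open S"
    then have "openin T {u \<in> topspace T. X u \<in> S}"
      by (intro openin_continuous_map_preimage[OF X]) simp
    moreover have "{u \<in> topspace T. X u \<in> S} = X -` S \<inter> space \<mu>"
      by (auto simp: space_haar topspace_eq)
    ultimately show "X -` S \<inter> space \<mu> \<in> sets \<mu>"
      by (metis openin_in_sets)
  qed
  have "compact (X ` topspace T)"
    using image_compactin[OF _ X] compact by (simp add: compact_space_def)
  then obtain B where "\<forall>z\<in>X ` topspace T. norm z \<le> B"
    using compact_imp_bounded bounded_iff by metis
  then show "\<exists>B. \<forall>u\<in>space \<mu>. norm (X u) \<le> B"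
    by (auto simp: space_haar topspace_eq)
qed

lemma measurable_translation:
  assumes a: "a \<in> carrier K"
  shows "(\<lambda>u. a \<otimes> u) \<in> measurable \<mu> \<mu>"
proof (rule measurable_sigma_sets[OF sets_haar])
  show "{U. openin T U} \<subseteq> Pow (topspace T)"
    using openin_subset by blast
  show "(\<lambda>u. a \<otimes> u) \<in> space \<mu> \<rightarrow> topspace T"
    using a by (auto simp: space_haar topspace_eq)
  have "continuous_map T T ((\<lambda>(x, y). x \<otimes> y) \<circ> (\<lambda>u. (a, u)))"
    using a by (intro continuous_map_compose[OF _ continuous_mult] continuous_map_pairedI)
      (simp_all add: topspace_eq)
  then have cont: "continuous_map T T (\<lambda>u. a \<otimes> u)"
    by (simp add: o_def)
  fix U assume "U \<in> {U. openin T U}"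
  then have "openin T {u \<in> topspace T. a \<otimes> u \<in> U}"
    by (intro openin_continuous_map_preimage[OF cont]) simp
  moreover have "{u \<in> topspace T. a \<otimes> u \<in> U} = (\<lambda>u. a \<otimes> u) -` U \<inter> space \<mu>"
    by (auto simp: space_haar topspace_eq)
  ultimately show "(\<lambda>u. a \<otimes> u) -` U \<inter> space \<mu> \<in> sets \<mu>"
    by (metis openin_in_sets)
qed

lemma integral_translation:
  assumes a: "a \<in> carrier K" and F: "F \<in> borel_measurable \<mu>"
  shows "(LINT u|\<mu>. F (a \<otimes> u)) = (LINT u|\<mu>. F u :: complex)"
proof -
  interpret prob_space \<mu> by (rule prob_space_haar)
  note meas = measurable_translation[OF a]
  have "distr \<mu> \<mu> (\<lambda>u. a \<otimes> u) = \<mu>"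
  proof (rule measure_eqI)
    fix B assume "B \<in> sets (distr \<mu> \<mu> (\<lambda>u. a \<otimes> u))"
    then have B: "B \<in> sets \<mu>" by simp
    then have "B \<subseteq> carrier K"
      using sets.sets_into_space space_haar by blast
    \<comment> \<open>Haar invariance is given for images of sets, so the preimage under translation
      by \<open>a\<close> is rewritten as the image under translation by
      \<open>inv a\<close>.\<close>
    then have "(\<lambda>u. a \<otimes> u) -` B \<inter> space \<mu> = (\<lambda>u. inv a \<otimes> u) ` B"
      using a by (force simp: space_haar m_assoc[symmetric] image_iff)
    then show "emeasure (distr \<mu> \<mu> (\<lambda>u. a \<otimes> u)) B = emeasure \<mu> B"
      using measure_haar[OF inv_closed[OF a] B] B
      by (simp add: emeasure_distr[OF meas] emeasure_eq_measure)
  qed simp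
  then show ?thesis
    using integral_distr[OF meas F] by simp
qed

text \<open>Unitarity moves \<open>s\<close> to the other side,
  \<open><v, \<rho>(s^-1 u) w> = <\<rho>(s) v, \<rho>(u) w>\<close>, and this is written in
  orthonormal coordinates. One family \<open>L\<close> serves all vectors, so \<open>v = w\<close>
  gives the same coordinate functions twice.\<close>

lemma matrix_coefficient_translate:
  assumes coeff: "matrix_coefficient K m G \<iota> f n \<phi> h v w"
    and \<iota>: "\<iota> \<in> lie_group_homs K E A m G" and G: "G \<subseteq> carrier (GL m)"
  obtains L where "\<And>x i. x \<in> carrier_vec n \<Longrightarrow> i < n \<Longrightarrow> bounded_rv \<mu> (L x i)"
    and "\<And>s u. s \<in> carrier K \<Longrightarrow> u \<in> carrier K \<Longrightarrow>
      f (inv s \<otimes> u) = (\<Sum>i<n. cnj (L v i s) * L w i u)"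
proof -
  have \<phi>: "\<phi> \<in> rational_homs m G n (carrier (GL n))" and h: "hermitian_inner_product n h"
    and inv_h: "\<And>u x y. u \<in> carrier K \<Longrightarrow> x \<in> carrier_vec n \<Longrightarrow> y \<in> carrier_vec n \<Longrightarrow>
      h (\<phi> (\<iota> u) *\<^sub>v x) (\<phi> (\<iota> u) *\<^sub>v y) = h x y"
    and v: "v \<in> carrier_vec n" and w: "w \<in> carrier_vec n"
    and f: "\<And>u. u \<in> carrier K \<Longrightarrow> f u = h v (\<phi> (\<iota> u) *\<^sub>v w)"
    using coeff unfolding matrix_coefficient_def by blast+
  define \<rho> where "\<rho> u = \<phi> (\<iota> u)" for u
  have \<iota>_hom: "\<iota> \<in> hom K (GL m\<lparr>carrier := G\<rparr>)"
    and \<iota>_smooth: "\<And>i j. i < m \<Longrightarrow> j < m \<Longrightarrow> smooth_function E A (\<lambda>u. \<iota> u $$ (i, j))"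
    using \<iota> unfolding lie_group_homs_def by blast+
  have \<phi>_hom: "\<phi> \<in> hom (GL m\<lparr>carrier := G\<rparr>) (GL n)"
    and \<phi>_regular: "\<And>i j. i < n \<Longrightarrow> j < n \<Longrightarrow> \<exists>p\<in>regular_functions m. \<forall>g\<in>G. \<phi> g $$ (i, j) = p g"
    using \<phi> unfolding rational_homs_def by auto
  have \<iota>_G: "\<iota> u \<in> G" if "u \<in> carrier K" for u
    using hom_in_carrier[OF \<iota>_hom that] by simp
  have \<rho>_GL: "\<rho> u \<in> carrier (GL n)" if "u \<in> carrier K" for u
    unfolding \<rho>_def using \<phi>_hom \<iota>_G[OF that] by (auto simp: hom_def)
  have \<rho>_mat: "\<rho> u \<in> carrier_mat n n" if "u \<in> carrier K" for u
    by (rule GL_carrierD(1)[OF \<rho>_GL[OF that]])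
  have \<rho>_mult: "\<rho> (s \<otimes> u) = \<rho> s * \<rho> u" if "s \<in> carrier K" "u \<in> carrier K" for s u
    using hom_mult[OF \<iota>_hom that] hom_mult[OF \<phi>_hom, of "\<iota> s" "\<iota> u"] \<iota>_G that
    by (simp add: \<rho>_def GL_mult)
  have \<rho>_cont: "continuous_map T euclidean (\<lambda>u. \<rho> u $$ (i, j))" if ij: "i < n" "j < n" for i j
  proof -
    obtain p where p: "p \<in> regular_functions m" "\<And>g. g \<in> G \<Longrightarrow> \<phi> g $$ (i, j) = p g"
      using \<phi>_regular[OF ij] by blast
    have "continuous_map T euclidean (\<lambda>u. p (\<iota> u))"
    proof (rule regular_function_continuous_map[OF p(1)])
      fix u assume "u \<in> topspace T"
      then have "\<iota> u \<in> carrier (GL m)"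
        using \<iota>_G G by (auto simp: topspace_eq)
      then show "\<iota> u \<in> carrier_mat m m \<and> Determinant.det (\<iota> u) \<noteq> 0"
        using GL_carrierD by blast
    qed (intro smooth_function_continuous_map[OF atlas] \<iota>_smooth)
    then show ?thesis
      by (rule continuous_map_eq) (simp add: topspace_eq \<rho>_def p(2) \<iota>_G)
  qed
  obtain l where l: "\<And>i. i < n \<Longrightarrow> linear_functional n (l i)"
    and h_eq: "\<And>x y. x \<in> carrier_vec n \<Longrightarrow> y \<in> carrier_vec n \<Longrightarrow>
      h x y = (\<Sum>i<n. cnj (l i x) * l i y)"
    using hermitian_sum_of_squares[OF h] by blast
  define L where "L x i u = l i (\<rho> u *\<^sub>v x)" for x i u
  show ?thesis
  proof (rule that)
    fix x :: "complex Matrix.vec" and i assume x: "x \<in> carrier_vec n" and i: "i < n"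
    \<comment> \<open>A linear functional of \<open>\<rho> u x\<close> is a linear combination, with
      coefficients independent of \<open>u\<close>, of the continuous entries of
      \<open>\<rho> u\<close>.\<close>
    have "continuous_map T euclidean (\<lambda>u. \<Sum>j<n. (\<Sum>k\<in>{0..<n}. \<rho> u $$ (j, k) * vec_index x k) *
        l i (unit_vec n j))"
      unfolding continuous_map_tendsto_iff
    proof (intro ballI tendsto_intros)
      fix u j k assume "u \<in> topspace T" "j \<in> {..<n}" "k \<in> {0..<n}"
      then show "((\<lambda>u. \<rho> u $$ (j, k)) \<longlongrightarrow> \<rho> u $$ (j, k)) (atin T u)"
        using \<rho>_cont[of j k] by (simp add: continuous_map_tendsto_iff)
    qed
    then have "continuous_map T euclidean (L x i)"
    proof (rule continuous_map_eq)
      fix u assume "u \<in> topspace T"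
      then have "\<rho> u \<in> carrier_mat n n"
        by (simp add: \<rho>_mat topspace_eq)
      then show "(\<Sum>j<n. (\<Sum>k\<in>{0..<n}. \<rho> u $$ (j, k) * vec_index x k) * l i (unit_vec n j)) = L x i u"
        using x linear_functional_expand[OF l[OF i], of "\<rho> u *\<^sub>v x"]
        by (simp add: L_def scalar_prod_def)
    qed
    then show "bounded_rv \<mu> (L x i)"
      by (rule continuous_bounded_rv)
  next
    fix s u assume s: "s \<in> carrier K" and u: "u \<in> carrier K"
    have su: "inv s \<otimes> u \<in> carrier K"
      using s u by simp
    have "f (inv s \<otimes> u) = h v (\<rho> (inv s \<otimes> u) *\<^sub>v w)"
      unfolding \<rho>_def by (rule f[OF su])
    also have "\<dots> = h (\<rho> s *\<^sub>v v) (\<rho> s *\<^sub>v (\<rho> (inv s \<otimes> u) *\<^sub>v w))"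
      unfolding \<rho>_def by (rule inv_h[symmetric]) (use s v w \<rho>_mat[OF su] in \<open>auto simp: \<rho>_def\<close>)
    also have "\<rho> s *\<^sub>v (\<rho> (inv s \<otimes> u) *\<^sub>v w) = (\<rho> s * \<rho> (inv s \<otimes> u)) *\<^sub>v w"
      by (rule assoc_mult_mat_vec[symmetric]) (use s su w \<rho>_mat in auto)
    also have "\<rho> s * \<rho> (inv s \<otimes> u) = \<rho> u"
      using s u by (simp add: \<rho>_mult[OF s su, symmetric] m_assoc[symmetric])
    also have "h (\<rho> s *\<^sub>v v) (\<rho> u *\<^sub>v w) = (\<Sum>i<n. cnj (L v i s) * L w i u)"
      unfolding L_def
      using mult_mat_vec_carrier[OF \<rho>_mat[OF s] v] mult_mat_vec_carrier[OF \<rho>_mat[OF u] w]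
      by (rule h_eq)
    finally show "f (inv s \<otimes> u) = (\<Sum>i<n. cnj (L v i s) * L w i u)" .
  qed
qed

end

section \<open>From matrix coefficients on the compact group to averages of powers\<close>

theorem proposition5p11:
  fixes K :: "('a, 'b) monoid_scheme"
    and T :: "'a topology"
    and E :: "'e::euclidean_space set"
    and A :: "('a set \<times> ('a \<Rightarrow> 'e)) set"
    and m :: nat
    and G :: "complex mat set"
    and \<iota> :: "'a \<Rightarrow> complex mat"
    and \<mu> :: "'a measure"
    and f g :: "'a \<Rightarrow> complex"
  assumes "lie_group K T E A" and "compact_space T" and "connected_space T"
    and "complexification K E A m G \<iota>"
    and "haar_probability K T \<mu>"
    and "K_finite K m G \<iota> f" and "K_finite K m G \<iota> g"
    and "positive_definite K m G \<iota> f"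
    and "\<And>k::nat. k \<ge> 1 \<Longrightarrow> Cst \<mu> (\<lambda>u. f u ^ k) = 0"
  shows "finite {k::nat. Cst \<mu> (\<lambda>u. f u ^ k * g u) \<noteq> 0}"
proof -
  interpret compact_haar K T E A \<mu>
    using assms(1,2,5) by (simp add: compact_haar_def compact_haar_axioms_def)
  interpret prob_space \<mu> by (rule prob_space_haar)
  have \<iota>: "\<iota> \<in> lie_group_homs K E A m G" and G: "G \<subseteq> carrier (GL m)"
    using assms(4) unfolding complexification_def linear_algebraic_group_def
    by (auto dest: subgroup.subset)
  obtain n \<phi> h v where f: "matrix_coefficient K m G \<iota> f n \<phi> h v v"
    using assms(8) unfolding positive_definite_def by blast
  obtain n' \<phi>' h' a b where g: "matrix_coefficient K m G \<iota> g n' \<phi>' h' a b"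
    using assms(7) unfolding K_finite_def by blast
  have v: "v \<in> carrier_vec n" and ab: "a \<in> carrier_vec n'" "b \<in> carrier_vec n'"
    using f g unfolding matrix_coefficient_def by blast+
  obtain L where L: "\<And>x i. x \<in> carrier_vec n \<Longrightarrow> i < n \<Longrightarrow> bounded_rv \<mu> (L x i)"
    and f_eq: "\<And>s u. s \<in> carrier K \<Longrightarrow> u \<in> carrier K \<Longrightarrow>
      f (inv\<^bsub>K\<^esub> s \<otimes>\<^bsub>K\<^esub> u) = (\<Sum>i<n. cnj (L v i s) * L v i u)"
    using matrix_coefficient_translate[OF f \<iota> G] by blast
  obtain L' where L': "\<And>x i. x \<in> carrier_vec n' \<Longrightarrow> i < n' \<Longrightarrow> bounded_rv \<mu> (L' x i)"
    and g_eq: "\<And>s u. s \<in> carrier K \<Longrightarrow> u \<in> carrier K \<Longrightarrow>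
      g (inv\<^bsub>K\<^esub> s \<otimes>\<^bsub>K\<^esub> u) = (\<Sum>j<n'. cnj (L' a j s) * L' b j u)"
    using matrix_coefficient_translate[OF g \<iota> G] by blast
  \<comment> \<open>At \<open>s = 1\<close> the translation formula represents \<open>f\<close> on
    \<open>K\<close> by a bounded measurable function; the same works for \<open>g\<close>.\<close>
  have f_meas: "f \<in> borel_measurable \<mu>"
  proof -
    have "bounded_rv \<mu> (\<lambda>u. \<Sum>i<n. cnj (L v i \<one>\<^bsub>K\<^esub>) * L v i u)"
      by (intro bounded_rv_sum bounded_rv_mult bounded_rv_const L v) simp
    then have "(\<lambda>u. \<Sum>i<n. cnj (L v i \<one>\<^bsub>K\<^esub>) * L v i u) \<in> borel_measurable \<mu>"
      by (simp add: bounded_rv_def)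
    then show ?thesis
      by (rule measurable_cong[THEN iffD1, rotated])
        (use f_eq[of "\<one>\<^bsub>K\<^esub>"] in \<open>simp add: space_haar\<close>)
  qed
  have g_meas: "g \<in> borel_measurable \<mu>"
  proof -
    have "bounded_rv \<mu> (\<lambda>u. \<Sum>j<n'. cnj (L' a j \<one>\<^bsub>K\<^esub>) * L' b j u)"
      by (intro bounded_rv_sum bounded_rv_mult bounded_rv_const L' ab) simp
    then have "(\<lambda>u. \<Sum>j<n'. cnj (L' a j \<one>\<^bsub>K\<^esub>) * L' b j u) \<in> borel_measurable \<mu>"
      by (simp add: bounded_rv_def)
    then show ?thesis
      by (rule measurable_cong[THEN iffD1, rotated])
        (use g_eq[of "\<one>\<^bsub>K\<^esub>"] in \<open>simp add: space_haar\<close>)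
  qed
  \<comment> \<open>The coordinates are those of the orbits of \<open>v\<close>, \<open>a\<close>
    and \<open>b\<close>. Positive-definiteness of \<open>f\<close> is what makes the same family
    \<open>L v\<close> appear in both arguments.\<close>
  interpret power_family \<mu> n n' "L v" "L' a" "L' b" "\<lambda>k. Cst \<mu> (\<lambda>u. f u ^ k * g u)"
  proof
    show "(LINT u|\<mu>. (\<Sum>i<n. cnj (L v i s) * L v i u) ^ k) = 0"
      if "k \<ge> 1" "s \<in> space \<mu>" for k s
    proof -
      have "(LINT u|\<mu>. (\<Sum>i<n. cnj (L v i s) * L v i u) ^ k) =
          (LINT u|\<mu>. f (inv\<^bsub>K\<^esub> s \<otimes>\<^bsub>K\<^esub> u) ^ k)"
        using that by (intro Bochner_Integration.integral_cong) (simp_all add: f_eq space_haar)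
      also have "\<dots> = (LINT u|\<mu>. f u ^ k)"
        using that f_meas by (intro integral_translation[where F = "\<lambda>u. f u ^ k"])
          (auto simp: space_haar)
      finally show ?thesis
        using assms(9)[OF that(1)] by (simp add: Cst_def)
    qed
    show "(LINT u|\<mu>. (\<Sum>i<n. cnj (L v i s) * L v i u) ^ k * (\<Sum>j<n'. cnj (L' a j s) * L' b j u)) =
        Cst \<mu> (\<lambda>u. f u ^ k * g u)" if "s \<in> space \<mu>" for s k
    proof -
      have "(LINT u|\<mu>. (\<Sum>i<n. cnj (L v i s) * L v i u) ^ k * (\<Sum>j<n'. cnj (L' a j s) * L' b j u)) =
          (LINT u|\<mu>. f (inv\<^bsub>K\<^esub> s \<otimes>\<^bsub>K\<^esub> u) ^ k * g (inv\<^bsub>K\<^esub> s \<otimes>\<^bsub>K\<^esub> u))"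
        using that by (intro Bochner_Integration.integral_cong) (simp_all add: f_eq g_eq space_haar)
      also have "\<dots> = (LINT u|\<mu>. f u ^ k * g u)"
        using that f_meas g_meas by (intro integral_translation[where F = "\<lambda>u. f u ^ k * g u"])
          (auto simp: space_haar)
      finally show ?thesis
        by (simp add: Cst_def)
    qed
  qed (use L L' v ab in auto)
  show ?thesis
    by (rule finite_C_nonzero)
qed

end
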